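(* Let $t,x,w\ge 0$ be real numbers. For each integer $M\ge 2$, choose a vector $\lambda_M\in\mathbb{R}^M$ with $\|\lambda_M\|_2=w$ and a Brownian motion $(B^M_{s,x,(M-1)\lambda_M/2})_{s\ge0}$ on $\mathbb{R}^M$ with initial distribution $\sigma_{M,x,(M-1)\lambda_M/2}$ and drift vector $(M-1)\lambda_M/2$. Then for $M\to\infty$, the random variables $\big\|B^M_{2t/(M-1),x,(M-1)\lambda_M/2}\big\|_2$ tend in probability to $$\sqrt{x^2+w^2t^2+2t\sqrt{x^2w^2+1}}.$$
   Context: For $x\ge0$, $\sigma_{M,x}$ denotes the uniform distribution on the sphere $x\cdot S^{M-1}\subset\mathbb{R}^M$ (with $\sigma_{M,0}=\delta_0$). For $\lambda\in\mathbb{R}^M$, $\sigma_{M,x,\lambda}$ is the probability measure on $\mathbb{R}^M$ given by $$d\sigma_{M,x,\lambda}(y)=\frac{1}{Z}\,e^{\langle\lambda,y\rangle}\,d\sigma_{M,x}(y),\qquad Z=\int e^{\langle\lambda,y\rangle}\,d\sigma_{M,x}(y).$$ (The constant $Z$ equals the one-dimensional Bessel function $J^B_{(M-1)/2}(x,\|\lambda\|_2)$, where $J^B_{k}(a,b)={}_0F_1(k+\tfrac12;a^2b^2/4)$.) A Brownian motion on $\mathbb{R}^M$ with drift vector $\lambda$ and initial distribution $\mu$ is a process $B_0+W_s+s\lambda$, $s\ge0$, where $W$ is a standard $M$-dimensional Brownian motion started at $0$ and $B_0\sim\mu$ is independent of $W$. *)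

theory Defs
  imports "HOL-Probability.Probability"
begin

text \<open>
  The dimension has to range over the natural numbers inside the statement, so \<open>\<real>\<^sup>n\<close> is represented by
  the extensional functions on \<open>{..<n}\<close> with the product Borel \<open>\<sigma>\<close>-algebra.  The Euclidean norm is
  \<open>L2_set y {..<n}\<close>.
\<close>

abbreviation borel_vec :: "nat \<Rightarrow> (nat \<Rightarrow> real) measure" where
  "borel_vec n \<equiv> (\<Pi>\<^sub>M i\<in>{..<n}. borel)"

definition vnorm :: "nat \<Rightarrow> (nat \<Rightarrow> real) \<Rightarrow> real" where
  "vnorm n y = L2_set y {..<n}"

definition vinner :: "nat \<Rightarrow> (nat \<Rightarrow> real) \<Rightarrow> (nat \<Rightarrow> real) \<Rightarrow> real" where
  "vinner n u v = (\<Sum>i<n. u i * v i)"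

definition vadd :: "nat \<Rightarrow> (nat \<Rightarrow> real) \<Rightarrow> (nat \<Rightarrow> real) \<Rightarrow> nat \<Rightarrow> real" where
  "vadd n u v = (\<lambda>i\<in>{..<n}. u i + v i)"

definition vscale :: "nat \<Rightarrow> real \<Rightarrow> (nat \<Rightarrow> real) \<Rightarrow> nat \<Rightarrow> real" where
  "vscale n c v = (\<lambda>i\<in>{..<n}. c * v i)"

text \<open>
  The uniform distribution on the sphere \<open>x \<cdot> S\<^bsup>n-1\<^esup>\<close> is the normalised cone measure: the image of the
  uniform distribution on the unit ball under \<open>y \<mapsto> x y / \<parallel>y\<parallel>\<close>.  The value at \<open>y = 0\<close> is irrelevant,
  since for \<open>n \<ge> 1\<close> the origin is a null set; for \<open>x = 0\<close> this is the point mass at \<open>0\<close>.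
\<close>

definition unit_ball_uniform :: "nat \<Rightarrow> (nat \<Rightarrow> real) measure" where
  "unit_ball_uniform n =
     uniform_measure (\<Pi>\<^sub>M i\<in>{..<n}. lborel)
       {y \<in> space (\<Pi>\<^sub>M i\<in>{..<n}. lborel). vnorm n y \<le> 1}"

definition sphere_uniform :: "nat \<Rightarrow> real \<Rightarrow> (nat \<Rightarrow> real) measure" where
  "sphere_uniform n x =
     distr (unit_ball_uniform n) (borel_vec n) (\<lambda>y. vscale n (x / vnorm n y) y)"

definition sphere_tilted :: "nat \<Rightarrow> real \<Rightarrow> (nat \<Rightarrow> real) \<Rightarrow> (nat \<Rightarrow> real) measure" where
  "sphere_tilted n x l =
     (let Z = (\<integral>y. exp (vinner n l y) \<partial>sphere_uniform n x)
      in density (sphere_uniform n x) (\<lambda>y. ennreal (exp (vinner n l y) / Z)))"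

text \<open>
  Time is \<open>{0..}\<close>; values of a process at negative times are ignored.  The starting value and path
  continuity are only required almost surely.
\<close>

definition standard_brownian_motion ::
  "'a measure \<Rightarrow> nat \<Rightarrow> (real \<Rightarrow> 'a \<Rightarrow> nat \<Rightarrow> real) \<Rightarrow> bool" where
  "standard_brownian_motion P n W \<longleftrightarrow>
     prob_space P \<and>
     (\<forall>s\<ge>0. W s \<in> P \<rightarrow>\<^sub>M borel_vec n) \<and>
     (AE \<omega> in P. \<forall>i<n. W 0 \<omega> i = 0) \<and>
     (\<forall>r s. 0 \<le> r \<and> r < s \<longrightarrow>
        distr P (borel_vec n) (\<lambda>\<omega>. vadd n (W s \<omega>) (vscale n (-1) (W r \<omega>))) =
        (\<Pi>\<^sub>M i\<in>{..<n}. density lborel (\<lambda>z. ennreal (normal_density 0 (sqrt (s - r)) z)))) \<and>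
     (\<forall>(k::nat) (\<tau>::nat \<Rightarrow> real). 0 \<le> \<tau> 0 \<and> (\<forall>j<k. \<tau> j < \<tau> (Suc j)) \<longrightarrow>
        prob_space.indep_vars P (\<lambda>_. borel_vec n)
          (\<lambda>j \<omega>. vadd n (W (\<tau> (Suc j)) \<omega>) (vscale n (-1) (W (\<tau> j) \<omega>))) {..<k}) \<and>
     (AE \<omega> in P. \<forall>i<n. continuous_on {0..} (\<lambda>s. W s \<omega> i))"

text \<open>
  The library's \<open>indep_var\<close> forces both random variables to have the same value type, so
  independence of the starting point from the whole path is expressed through \<open>indep_set\<close> on the
  generated \<open>\<sigma>\<close>-algebras.
\<close>

definition brownian_motion_drift ::
  "'a measure \<Rightarrow> nat \<Rightarrow> (nat \<Rightarrow> real) measure \<Rightarrow> (nat \<Rightarrow> real) \<Rightarrow>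
     (real \<Rightarrow> 'a \<Rightarrow> nat \<Rightarrow> real) \<Rightarrow> bool" where
  "brownian_motion_drift P n \<mu> d B \<longleftrightarrow>
     (\<exists>B0 W. standard_brownian_motion P n W \<and>
        B0 \<in> P \<rightarrow>\<^sub>M borel_vec n \<and> distr P (borel_vec n) B0 = \<mu> \<and>
        prob_space.indep_set P
          {B0 -` A \<inter> space P | A. A \<in> sets (borel_vec n)}
          {(\<lambda>\<omega>. \<lambda>s\<in>{0..}. W s \<omega>) -` A \<inter> space P | A. A \<in> sets (\<Pi>\<^sub>M s\<in>{0..}. borel_vec n)} \<and>
        (\<forall>s\<ge>0. \<forall>\<omega>\<in>space P. B s \<omega> = vadd n (vadd n (B0 \<omega>) (W s \<omega>)) (vscale n s d)))"

text \<open>The random variables may live on different probability spaces.\<close>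

definition tendsto_in_prob ::
  "(nat \<Rightarrow> 'a measure) \<Rightarrow> (nat \<Rightarrow> 'a \<Rightarrow> real) \<Rightarrow> real \<Rightarrow> bool" where
  "tendsto_in_prob P X c \<longleftrightarrow>
     (\<forall>\<epsilon>>0. (\<lambda>n. measure (P n) {\<omega> \<in> space (P n). \<bar>X n \<omega> - c\<bar> > \<epsilon>}) \<longlonglongrightarrow> 0)"

end

theory Submission
  imports Defs
begin

text \<open>
  Write \<open>N = M - 1\<close>, \<open>s = 2 t / N\<close> for the time, \<open>a = x w\<close>, \<open>G\<close> for the value of the driftless Brownian
  motion at time \<open>s\<close>, and \<open>v = \<langle>l, B0\<rangle>\<close>.  The drift has moved the process by \<open>t l\<close> up to time \<open>s\<close>, so its
  squared norm is
  \<open>\<parallel>B0 + t l\<parallel>\<^sup>2 + 2 \<langle>B0 + t l, G\<rangle> + \<parallel>G\<parallel>\<^sup>2\<close>, where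
  \<open>\<parallel>B0 + t l\<parallel>\<^sup>2 = x\<^sup>2 + 2 t v + w\<^sup>2 t\<^sup>2\<close>.

  The Gaussian vector \<open>G\<close> has \<open>N + 1\<close> independent coordinates of variance \<open>s\<close>, so \<open>\<parallel>G\<parallel>\<^sup>2\<close> has mean
  \<open>2 t + 2 t / N\<close> and variance of order \<open>1 / N\<close>.  The vector \<open>B0 + t l\<close> is bounded and independent of \<open>G\<close>,
  so the cross term has second moment of order \<open>s\<close>.

  The heart is the concentration of \<open>v\<close> under the tilted distribution.  Heuristically, \<open>v\<close> has a density
  proportional to \<open>exp (N v / 2) (1 - v\<^sup>2 / a\<^sup>2)\<^bsup>(N - 2) / 2\<^esup>\<close>, whose mass gathers at the larger root
  \<open>sqrt (1 + a\<^sup>2) - 1\<close> of \<open>q(v) = v\<^sup>2 + 2 v - a\<^sup>2\<close>.  The proof avoids this density.  The infinitesimal rotations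
  in the coordinate planes integrate to zero over the sphere; combined with the weights \<open>l i\<close> they give
  the integration by parts formula \<open>sphere_uniform_stein\<close>,
  \<open>E (N v \<phi>(v) + (v\<^sup>2 - a\<^sup>2) \<phi>'(v)) = 0\<close>.
  For \<open>\<phi>(v) = q(v) exp (N v / 2)\<close> this says that under the tilted distribution
  \<open>E q(v)\<^sup>2 = (2 / N) E ((a\<^sup>2 - v\<^sup>2) q'(v))\<close>, which is of order \<open>1 / N\<close>.  Since the other root of \<open>q\<close> keeps
  distance at least \<open>1\<close> from \<open>[-a, a]\<close>, the mean square distance of \<open>v\<close> from the larger root is no larger
  (\<open>sphere_tilted_variance\<close>).

  Altogether the squared norm has mean square distance of order \<open>1 / N\<close> from
  \<open>x\<^sup>2 + 2 t (sqrt (1 + a\<^sup>2) - 1) + w\<^sup>2 t\<^sup>2 + 2 t\<close> (\<open>brownian_motion_norm_second_moment\<close>), and Markov's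
  inequality concludes.
\<close>

section \<open>Euclidean geometry of extensional vectors\<close>

lemma vnorm_nonneg: "vnorm n y \<ge> 0" by (simp add: vnorm_def)

lemma vnorm_power2: "(vnorm n y)\<^sup>2 = (\<Sum>i<n. (y i)\<^sup>2)"
  by (simp add: vnorm_def L2_set_def sum_nonneg)

lemma vnorm_vscale: "vnorm n (vscale n c y) = \<bar>c\<bar> * vnorm n y"
proof -
  have "(\<Sum>i<n. (vscale n c y i)\<^sup>2) = (\<Sum>i<n. c\<^sup>2 * (y i)\<^sup>2)"
    by (intro sum.cong) (auto simp: vscale_def power_mult_distrib)
  then show ?thesis
    by (simp add: vnorm_def L2_set_def sum_distrib_left[symmetric] real_sqrt_mult)
qed

lemma vinner_vscale: "vinner n (vscale n c l) y = c * vinner n l y"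
  by (simp add: vinner_def vscale_def sum_distrib_left mult.assoc)

lemma abs_component_le_vnorm:
  assumes "i < n" shows "\<bar>y i\<bar> \<le> vnorm n y"
proof -
  have "\<bar>y i\<bar> \<le> L2_set (\<lambda>i. \<bar>y i\<bar>) {..<n}" by (rule member_le_L2_set) (use assms in auto)
  then show ?thesis by (simp add: vnorm_def L2_set_def)
qed

lemma abs_vinner_le: "\<bar>vinner n l y\<bar> \<le> vnorm n l * vnorm n y"
proof -
  have "\<bar>vinner n l y\<bar> \<le> (\<Sum>i<n. \<bar>l i\<bar> * \<bar>y i\<bar>)"
    unfolding vinner_def abs_mult[symmetric] by (rule sum_abs)
  also have "\<dots> \<le> vnorm n l * vnorm n y" unfolding vnorm_def by (rule L2_set_mult_ineq)
  finally show ?thesis .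
qed

lemma vnorm_vadd_power2: "(vnorm n (vadd n u v))\<^sup>2 = (vnorm n u)\<^sup>2 + 2 * vinner n u v + (vnorm n v)\<^sup>2"
proof -
  have "(vnorm n (vadd n u v))\<^sup>2 = (\<Sum>i<n. (u i)\<^sup>2 + 2 * (u i * v i) + (v i)\<^sup>2)"
    unfolding vnorm_power2 vadd_def by (intro sum.cong) (auto simp: power2_sum)
  then show ?thesis
    by (simp add: vnorm_power2 vinner_def sum.distrib sum_distrib_left)
qed

lemma vnorm_vadd_le: "vnorm n (vadd n u v) \<le> vnorm n u + vnorm n v"
proof -
  have "vnorm n (vadd n u v) = L2_set (\<lambda>i. u i + v i) {..<n}"
    unfolding vnorm_def by (intro L2_set_cong) (auto simp: vadd_def)
  then show ?thesis unfolding vnorm_def by (simp add: L2_set_triangle_ineq)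
qed

lemma measurable_vnorm[measurable]: "vnorm n \<in> borel_measurable (borel_vec n)"
  unfolding vnorm_def L2_set_def by measurable

lemma measurable_vinner:
  assumes "f \<in> M \<rightarrow>\<^sub>M borel_vec n" "g \<in> M \<rightarrow>\<^sub>M borel_vec n"
  shows "(\<lambda>y. vinner n (f y) (g y)) \<in> borel_measurable M"
proof -
  have "(\<lambda>y. f y i) \<in> borel_measurable M" "(\<lambda>y. g y i) \<in> borel_measurable M" if "i < n" for i
    using that measurable_compose[OF assms(1) measurable_component_singleton[of i "{..<n}"]]
      measurable_compose[OF assms(2) measurable_component_singleton[of i "{..<n}"]] by auto
  then show ?thesis unfolding vinner_def by (intro borel_measurable_sum borel_measurable_times) auto
qed

lemma measurable_vinner_const[measurable]: "vinner n l \<in> borel_measurable (borel_vec n)"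
  unfolding vinner_def by measurable

lemma measurable_vscale[measurable]:
  assumes "c \<in> borel_measurable M" "f \<in> M \<rightarrow>\<^sub>M borel_vec n"
  shows "(\<lambda>y. vscale n (c y) (f y)) \<in> M \<rightarrow>\<^sub>M borel_vec n"
  unfolding vscale_def
proof (rule measurable_restrict)
  fix i assume "i \<in> {..<n}"
  then have "(\<lambda>y. f y i) \<in> borel_measurable M"
    using measurable_compose[OF assms(2) measurable_component_singleton[of i "{..<n}"]] by auto
  then show "(\<lambda>y. c y * f y i) \<in> borel_measurable M" using assms(1) by simp
qed

lemma measurable_vadd[measurable]:
  assumes "f \<in> M \<rightarrow>\<^sub>M borel_vec n" "g \<in> M \<rightarrow>\<^sub>M borel_vec n"
  shows "(\<lambda>y. vadd n (f y) (g y)) \<in> M \<rightarrow>\<^sub>M borel_vec n"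
  unfolding vadd_def
proof (rule measurable_restrict)
  fix i assume "i \<in> {..<n}"
  then have "(\<lambda>y. f y i) \<in> borel_measurable M" "(\<lambda>y. g y i) \<in> borel_measurable M"
    using measurable_compose[OF assms(1) measurable_component_singleton[of i "{..<n}"]]
      measurable_compose[OF assms(2) measurable_component_singleton[of i "{..<n}"]] by auto
  then show "(\<lambda>y. f y i + g y i) \<in> borel_measurable M" by simp
qed

section \<open>Planar rotations preserve Lebesgue measure\<close>

abbreviation lborel_vec :: "nat \<Rightarrow> (nat \<Rightarrow> real) measure" where
  "lborel_vec n \<equiv> (\<Pi>\<^sub>M i\<in>{..<n}. lborel)"

lemma sets_lborel_vec: "sets (lborel_vec n) = sets (borel_vec n)"
  by (intro sets_PiM_cong) auto

lemma space_lborel_vec: "space (lborel_vec n) = space (borel_vec n)"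
  by (simp add: space_PiM)

definition shear :: "nat \<Rightarrow> nat \<Rightarrow> real \<Rightarrow> (nat \<Rightarrow> real) \<Rightarrow> nat \<Rightarrow> real" where
  "shear i j c y = y(i := y i + c * y j)"

definition plane_rot :: "nat \<Rightarrow> nat \<Rightarrow> real \<Rightarrow> (nat \<Rightarrow> real) \<Rightarrow> nat \<Rightarrow> real" where
  "plane_rot i j \<theta> y = y(i := cos \<theta> * y i - sin \<theta> * y j, j := sin \<theta> * y i + cos \<theta> * y j)"

lemma measurable_shear:
  assumes "i < n" "j < n"
  shows "shear i j c \<in> borel_vec n \<rightarrow>\<^sub>M borel_vec n"
proof -
  have "{..<n} = {..<n} \<union> {i}" using assms by auto
  then show ?thesis unfolding shear_def
    by (rule measurable_fun_upd) (use assms in auto)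
qed

lemma measurable_plane_rot:
  assumes "i < n" "j < n"
  shows "plane_rot i j \<theta> \<in> borel_vec n \<rightarrow>\<^sub>M borel_vec n"
proof -
  have 1: "{..<n} = {..<n} \<union> {i}" and 2: "{..<n} = {..<n} \<union> {j}" using assms by auto
  show ?thesis unfolding plane_rot_def
    by (rule measurable_fun_upd[OF 2] measurable_fun_upd[OF 1])+ (use assms in auto)
qed

text \<open>
  By Fubini the shear may be applied to the \<open>i\<close>-th coordinate with all others fixed, and there it is a
  translation.
\<close>

lemma distr_lborel_vec_shear:
  assumes "i < n" "j < n" "i \<noteq> j"
  shows "distr (lborel_vec n) (lborel_vec n) (shear i j c) = lborel_vec n"
proof (rule measure_eqI)
  fix A assume "A \<in> sets (distr (lborel_vec n) (lborel_vec n) (shear i j c))"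
  then have A[measurable]: "A \<in> sets (lborel_vec n)" by simp
  have sh[measurable]: "shear i j c \<in> lborel_vec n \<rightarrow>\<^sub>M lborel_vec n"
    using measurable_shear[OF assms(1,2)] sets_lborel_vec[of n]
    by (simp cong: measurable_cong_sets)
  define J where "J = {..<n} - {i}"
  have J: "{..<n} = insert i J" "i \<notin> J" "finite J" "j \<in> J"
    using assms by (auto simp: J_def)
  interpret product_sigma_finite "\<lambda>_::nat. lborel :: real measure" ..
  have ins: "(\<integral>\<^sup>+ y. f y \<partial>lborel_vec n) =
      (\<integral>\<^sup>+ x. (\<integral>\<^sup>+ y. f (x(i := y)) \<partial>lborel) \<partial>(\<Pi>\<^sub>M i\<in>J. lborel))"
    if "f \<in> borel_measurable (lborel_vec n)" for f
    using that J unfolding J(1) by (intro product_nn_integral_insert) auto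
  have "emeasure (distr (lborel_vec n) (lborel_vec n) (shear i j c)) A
     = (\<integral>\<^sup>+ y. indicator A y \<partial>distr (lborel_vec n) (lborel_vec n) (shear i j c))"
    by simp
  also have "\<dots> = (\<integral>\<^sup>+ y. indicator A (shear i j c y) \<partial>lborel_vec n)"
    by (rule nn_integral_distr) measurable
  also have "\<dots> = (\<integral>\<^sup>+ x. (\<integral>\<^sup>+ y. indicator A (shear i j c (x(i := y))) \<partial>lborel) \<partial>(\<Pi>\<^sub>M i\<in>J. lborel))"
    by (rule ins) measurable
  also have "\<dots> = (\<integral>\<^sup>+ x. (\<integral>\<^sup>+ y. indicator A (x(i := y)) \<partial>lborel) \<partial>(\<Pi>\<^sub>M i\<in>J. lborel))"
  proof (rule nn_integral_cong)
    fix x :: "nat \<Rightarrow> real" assume x: "x \<in> space (\<Pi>\<^sub>M i\<in>J. lborel)"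
    have m: "(\<lambda>y. x(i := y)) \<in> borel \<rightarrow>\<^sub>M lborel_vec n"
      unfolding J(1) using x by (intro measurable_fun_upd[where J = J]) auto
    have m': "(\<lambda>y. indicator A (x(i := y)) :: ennreal) \<in> borel_measurable borel"
      by (rule measurable_compose[OF m]) measurable
    have "shear i j c (x(i := y)) = x(i := c * x j + 1 * y)" for y
      using assms by (auto simp: shear_def)
    then show "(\<integral>\<^sup>+ y. indicator A (shear i j c (x(i := y))) \<partial>lborel) =
        (\<integral>\<^sup>+ y. indicator A (x(i := y)) \<partial>lborel)"
      using nn_integral_real_affine[OF m', of 1 "c * x j"] by simp
  qed
  also have "\<dots> = (\<integral>\<^sup>+ y. indicator A y \<partial>lborel_vec n)"
    by (rule ins[symmetric]) measurable
  finally show "emeasure (distr (lborel_vec n) (lborel_vec n) (shear i j c)) A = emeasure (lborel_vec n) A"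
    by simp
qed simp

text \<open>
  This factorisation reduces the invariance of Lebesgue measure under rotations to the invariance under
  shears.  The shear coefficient is \<open>- tan (\<theta> / 2)\<close>.
\<close>

lemma plane_rot_eq_shears:
  assumes "sin \<theta> \<noteq> 0" "i \<noteq> j"
  defines "a \<equiv> (cos \<theta> - 1) / sin \<theta>"
  shows "plane_rot i j \<theta> y = shear i j a (shear j i (sin \<theta>) (shear i j a y))"
proof -
  have a: "a * sin \<theta> = cos \<theta> - 1" using assms by simp
  have s: "sin \<theta> * sin \<theta> = 1 - cos \<theta> * cos \<theta>"
    using sin_squared_eq[of \<theta>] by (simp add: power2_eq_square)
  have "sin \<theta> * (a * (1 + cos \<theta>)) = (a * sin \<theta>) * (1 + cos \<theta>)" by algebra
  also have "\<dots> = sin \<theta> * (- sin \<theta>)" using s by (simp add: a algebra_simps)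
  finally have b: "a * (1 + cos \<theta>) = - sin \<theta>" using assms(1) mult_left_cancel by blast
  have *: "sin \<theta> * (y i + a * y j) + y j = sin \<theta> * y i + cos \<theta> * y j"
  proof -
    have "sin \<theta> * (y i + a * y j) + y j = sin \<theta> * y i + (a * sin \<theta> + 1) * y j"
      by (simp add: algebra_simps)
    then show ?thesis by (simp add: a)
  qed
  have **: "y i + a * y j + a * (sin \<theta> * y i + cos \<theta> * y j) = cos \<theta> * y i - sin \<theta> * y j"
  proof -
    have "y i + a * y j + a * (sin \<theta> * y i + cos \<theta> * y j)
       = (a * sin \<theta> + 1) * y i + (a * (1 + cos \<theta>)) * y j"
      by (simp add: algebra_simps)
    then show ?thesis by (simp only: a b) simp
  qed
  show ?thesis
    using assms(2) * ** by (auto simp: plane_rot_def shear_def fun_eq_iff add.commute)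
qed

lemma distr_lborel_vec_plane_rot:
  assumes "i < n" "j < n" "i \<noteq> j" "sin \<theta> \<noteq> 0"
  shows "distr (lborel_vec n) (lborel_vec n) (plane_rot i j \<theta>) = lborel_vec n"
proof -
  have m: "shear i j c \<in> lborel_vec n \<rightarrow>\<^sub>M lborel_vec n" "shear j i c \<in> lborel_vec n \<rightarrow>\<^sub>M lborel_vec n" for c
    using measurable_shear[OF assms(1,2)] measurable_shear[OF assms(2,1)] sets_lborel_vec[of n]
    by (simp_all cong: measurable_cong_sets)
  define a where "a = (cos \<theta> - 1) / sin \<theta>"
  have "plane_rot i j \<theta> = shear i j a \<circ> (shear j i (sin \<theta>) \<circ> shear i j a)"
    using plane_rot_eq_shears[OF assms(4,3)] by (auto simp: a_def)
  then have "distr (lborel_vec n) (lborel_vec n) (plane_rot i j \<theta>) =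
     distr (distr (distr (lborel_vec n) (lborel_vec n) (shear i j a)) (lborel_vec n) (shear j i (sin \<theta>)))
       (lborel_vec n) (shear i j a)"
    using m by (simp add: distr_distr comp_assoc)
  then show ?thesis
    using distr_lborel_vec_shear assms by simp
qed

lemma sum_lessThan_split_pair:
  fixes f :: "nat \<Rightarrow> 'b::ab_group_add"
  assumes "i < n" "j < n" "i \<noteq> j"
  shows "(\<Sum>k<n. f k) = f i + f j + (\<Sum>k\<in>{..<n} - {i, j}. f k)"
proof -
  have "{..<n} - {i, j} = {..<n} - {i} - {j}" by auto
  then show ?thesis
    using assms by (simp add: sum.remove[of "{..<n}" i] sum.remove[of "{..<n} - {i}" j] add.assoc)
qed

lemma plane_rot_vnorm:
  assumes "i < n" "j < n" "i \<noteq> j"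
  shows "vnorm n (plane_rot i j \<theta> y) = vnorm n y"
proof -
  have "(cos \<theta> * y i - sin \<theta> * y j)\<^sup>2 + (sin \<theta> * y i + cos \<theta> * y j)\<^sup>2
      = ((sin \<theta>)\<^sup>2 + (cos \<theta>)\<^sup>2) * ((y i)\<^sup>2 + (y j)\<^sup>2)"
    by algebra
  then have *: "(cos \<theta> * y i - sin \<theta> * y j)\<^sup>2 + (sin \<theta> * y i + cos \<theta> * y j)\<^sup>2 = (y i)\<^sup>2 + (y j)\<^sup>2"
    by simp
  have "(\<Sum>k<n. (plane_rot i j \<theta> y k)\<^sup>2) = (\<Sum>k<n. (y k)\<^sup>2)"
    using * assms(3) unfolding sum_lessThan_split_pair[OF assms]
    by (auto simp: plane_rot_def intro!: sum.cong)
  then show ?thesis by (simp add: vnorm_def L2_set_def)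
qed

lemma plane_rot_vinner:
  assumes "i < n" "j < n" "i \<noteq> j"
  shows "vinner n l (plane_rot i j \<theta> y) = (\<Sum>k\<in>{..<n} - {i, j}. l k * y k)
     + l i * (cos \<theta> * y i - sin \<theta> * y j) + l j * (sin \<theta> * y i + cos \<theta> * y j)"
proof -
  have "(\<Sum>k\<in>{..<n} - {i, j}. l k * plane_rot i j \<theta> y k) = (\<Sum>k\<in>{..<n} - {i, j}. l k * y k)"
    by (intro sum.cong) (auto simp: plane_rot_def)
  then show ?thesis
    using assms(3) unfolding vinner_def sum_lessThan_split_pair[OF assms]
    by (simp add: plane_rot_def)
qed

lemma plane_rot_vscale:
  assumes "i < n" "j < n" "i \<noteq> j"
  shows "plane_rot i j \<theta> (vscale n c y) = vscale n c (plane_rot i j \<theta> y)"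
  using assms by (auto simp: plane_rot_def vscale_def fun_eq_iff algebra_simps)

section \<open>The uniform distribution on the sphere\<close>

definition unit_ball :: "nat \<Rightarrow> (nat \<Rightarrow> real) set" where
  "unit_ball n = {y \<in> space (lborel_vec n). vnorm n y \<le> 1}"

lemma unit_ball_sets: "unit_ball n \<in> sets (lborel_vec n)"
proof -
  have "{y \<in> space (borel_vec n). vnorm n y \<le> 1} \<in> sets (borel_vec n)" by measurable
  then show ?thesis by (simp only: unit_ball_def sets_lborel_vec space_lborel_vec)
qed

lemma unit_ball_uniform_eq: "unit_ball_uniform n = uniform_measure (lborel_vec n) (unit_ball n)"
  by (simp add: unit_ball_uniform_def unit_ball_def)

text \<open>
  The ball lies between the cubes \<open>[0, 1/n]\<^sup>n\<close> and \<open>[-1, 1]\<^sup>n\<close>.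
\<close>

lemma emeasure_unit_ball:
  assumes "n \<ge> 1"
  shows "emeasure (lborel_vec n) (unit_ball n) \<noteq> 0" "emeasure (lborel_vec n) (unit_ball n) \<noteq> \<infinity>"
proof -
  interpret product_sigma_finite "\<lambda>_::nat. lborel :: real measure" ..
  have box: "emeasure (lborel_vec n) (\<Pi>\<^sub>E i\<in>{..<n}. {a..b}) = ennreal (b - a) ^ n" if "a \<le> b" for a b :: real
    using that by (subst emeasure_PiM) auto
  have "unit_ball n \<subseteq> (\<Pi>\<^sub>E i\<in>{..<n}. {-1..1})"
  proof
    fix y assume y: "y \<in> unit_ball n"
    have "\<bar>y i\<bar> \<le> 1" if "i < n" for i
      using abs_component_le_vnorm[OF that, of y] y by (simp add: unit_ball_def)
    then show "y \<in> (\<Pi>\<^sub>E i\<in>{..<n}. {-1..1})"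
      using y by (auto simp: unit_ball_def space_PiM PiE_iff abs_le_iff)
  qed
  then have "emeasure (lborel_vec n) (unit_ball n) \<le> ennreal 2 ^ n"
    using box[of "-1" 1] emeasure_mono[of "unit_ball n" "\<Pi>\<^sub>E i\<in>{..<n}. {-1..1::real}" "lborel_vec n"]
    by (auto intro!: sets_PiM_I_finite)
  also have "\<dots> < \<infinity>" using ennreal_less_top[of "2 ^ n"] by (simp add: ennreal_power[symmetric])
  finally show "emeasure (lborel_vec n) (unit_ball n) \<noteq> \<infinity>" by simp
  have sub: "(\<Pi>\<^sub>E i\<in>{..<n}. {0..1 / real n}) \<subseteq> unit_ball n"
  proof
    fix y :: "nat \<Rightarrow> real" assume y: "y \<in> (\<Pi>\<^sub>E i\<in>{..<n}. {0..1 / real n})"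
    have "vnorm n y \<le> (\<Sum>i<n. \<bar>y i\<bar>)" unfolding vnorm_def by (rule L2_set_le_sum_abs)
    also have "\<dots> \<le> (\<Sum>i<n. 1 / real n)" using y by (intro sum_mono) (auto simp: PiE_iff)
    also have "\<dots> = 1" using assms by simp
    finally show "y \<in> unit_ball n" using y by (auto simp: unit_ball_def space_PiM PiE_iff)
  qed
  have "0 < ennreal (1 / real n) ^ n" using assms by (simp add: ennreal_power)
  also have "\<dots> \<le> emeasure (lborel_vec n) (unit_ball n)"
    using box[of 0 "1 / real n"] emeasure_mono[OF sub unit_ball_sets] by simp
  finally show "emeasure (lborel_vec n) (unit_ball n) \<noteq> 0" by simp
qed

lemma prob_space_unit_ball_uniform: "n \<ge> 1 \<Longrightarrow> prob_space (unit_ball_uniform n)"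
  unfolding unit_ball_uniform_eq by (intro prob_space_uniform_measure emeasure_unit_ball)

lemma sets_unit_ball_uniform: "sets (unit_ball_uniform n) = sets (borel_vec n)"
  by (simp add: unit_ball_uniform_eq sets_lborel_vec)

lemma measurable_normalise:
  "(\<lambda>y. vscale n (x / vnorm n y) y) \<in> unit_ball_uniform n \<rightarrow>\<^sub>M borel_vec n"
proof -
  have "(\<lambda>y. vscale n (x / vnorm n y) y) \<in> borel_vec n \<rightarrow>\<^sub>M borel_vec n" by measurable
  then show ?thesis by (simp add: sets_unit_ball_uniform cong: measurable_cong_sets)
qed

lemma prob_space_sphere_uniform: "n \<ge> 1 \<Longrightarrow> prob_space (sphere_uniform n x)"
  unfolding sphere_uniform_def
  by (intro prob_space.prob_space_distr prob_space_unit_ball_uniform measurable_normalise)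

lemma sets_sphere_uniform[measurable_cong]: "sets (sphere_uniform n x) = sets (borel_vec n)"
  by (simp add: sphere_uniform_def)

lemma AE_sphere_uniform_vnorm:
  assumes "n \<ge> 1" "x \<ge> 0"
  shows "AE y in sphere_uniform n x. vnorm n y = x"
proof -
  interpret product_sigma_finite "\<lambda>_::nat. lborel :: real measure" ..
  have "emeasure (lborel_vec n) {\<lambda>i\<in>{..<n}. 0} = emeasure (lborel_vec n) (\<Pi>\<^sub>E i\<in>{..<n}. {0})"
    by (intro arg_cong[where f = "emeasure _"]) (auto simp: PiE_iff extensional_def)
  also have "\<dots> = 0" using assms by (subst emeasure_PiM) auto
  finally have z: "emeasure (lborel_vec n) {\<lambda>i\<in>{..<n}. 0} = 0" .
  have zs: "{\<lambda>i\<in>{..<n}. 0} \<in> sets (lborel_vec n)"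
  proof -
    have "{\<lambda>i\<in>{..<n}. 0::real} = (\<Pi>\<^sub>E i\<in>{..<n}. {0})" by (auto simp: PiE_iff extensional_def)
    then show ?thesis by (simp only:) (rule sets_PiM_I_finite; simp)
  qed
  have "AE y in lborel_vec n. y \<noteq> (\<lambda>i\<in>{..<n}. 0)"
    using z zs by (intro AE_I[where N = "{\<lambda>i\<in>{..<n}. 0}"]) auto
  then have "AE y in unit_ball_uniform n. y \<noteq> (\<lambda>i\<in>{..<n}. 0)"
    unfolding unit_ball_uniform_eq
    by (intro AE_uniform_measureI unit_ball_sets) auto
  moreover have "AE y in unit_ball_uniform n. y \<in> extensional {..<n}"
    using AE_space[of "unit_ball_uniform n"]
    by eventually_elim (auto simp: unit_ball_uniform_eq space_PiM PiE_iff)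
  ultimately have "AE y in unit_ball_uniform n. vnorm n (vscale n (x / vnorm n y) y) = x"
  proof eventually_elim
    case (elim y)
    have "vnorm n y \<noteq> 0"
    proof
      assume "vnorm n y = 0"
      then have "\<forall>i<n. y i = 0" by (auto simp: vnorm_def L2_set_eq_0_iff)
      then have "y = (\<lambda>i\<in>{..<n}. 0)" using elim(2) by (auto simp: fun_eq_iff extensional_def)
      with elim(1) show False by simp
    qed
    then show ?case using assms vnorm_nonneg[of n y] by (simp add: vnorm_vscale)
  qed
  then show ?thesis unfolding sphere_uniform_def
    by (subst AE_distr_iff[OF measurable_normalise]) auto
qed

lemma distr_unit_ball_uniform_plane_rot:
  assumes "i < n" "j < n" "i \<noteq> j" "sin \<theta> \<noteq> 0"
  shows "distr (unit_ball_uniform n) (borel_vec n) (plane_rot i j \<theta>) = unit_ball_uniform n"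
proof (rule measure_eqI)
  let ?L = "lborel_vec n" and ?R = "plane_rot i j \<theta>" and ?U = "unit_ball_uniform n"
  have m[measurable]: "?R \<in> ?L \<rightarrow>\<^sub>M ?L" and m': "?R \<in> ?U \<rightarrow>\<^sub>M borel_vec n"
    using measurable_plane_rot[OF assms(1,2)] sets_lborel_vec[of n] sets_unit_ball_uniform[of n]
    by (simp_all cong: measurable_cong_sets)
  note unit_ball_sets[measurable]
  fix E assume "E \<in> sets (distr (unit_ball_uniform n) (borel_vec n) ?R)"
  then have E[measurable]: "E \<in> sets ?L" by (simp add: sets_lborel_vec)
  have sp: "space ?U = space ?L" by (simp add: unit_ball_uniform_eq)
  have pre[measurable]: "?R -` E \<inter> space ?L \<in> sets ?L" by measurable
  have "emeasure (distr ?U (borel_vec n) ?R) E = emeasure ?U (?R -` E \<inter> space ?L)"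
    using E m' by (subst emeasure_distr) (auto simp: sets_lborel_vec sp)
  also have "\<dots> = emeasure ?L (unit_ball n \<inter> (?R -` E \<inter> space ?L)) / emeasure ?L (unit_ball n)"
    unfolding unit_ball_uniform_eq by (rule emeasure_uniform_measure) measurable
  also have "unit_ball n \<inter> (?R -` E \<inter> space ?L) = ?R -` (unit_ball n \<inter> E) \<inter> space ?L"
    using measurable_space[OF m] plane_rot_vnorm[OF assms(1-3)] by (auto simp: unit_ball_def)
  also have "emeasure ?L \<dots> = emeasure (distr ?L ?L ?R) (unit_ball n \<inter> E)"
    by (rule emeasure_distr[symmetric]) measurable
  also have "\<dots> = emeasure ?L (unit_ball n \<inter> E)"
    by (simp add: distr_lborel_vec_plane_rot assms)
  also have "emeasure ?L (unit_ball n \<inter> E) / emeasure ?L (unit_ball n) = emeasure ?U E"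
    unfolding unit_ball_uniform_eq by (rule emeasure_uniform_measure[symmetric]) measurable
  finally show "emeasure (distr ?U (borel_vec n) ?R) E = emeasure ?U E" .
qed (simp add: sets_unit_ball_uniform)

text \<open>
  Rotations commute with the radial projection onto the sphere, so the invariance passes from the
  ball to the sphere.
\<close>

lemma distr_sphere_uniform_plane_rot:
  assumes "i < n" "j < n" "i \<noteq> j" "sin \<theta> \<noteq> 0"
  shows "distr (sphere_uniform n x) (borel_vec n) (plane_rot i j \<theta>) = sphere_uniform n x"
proof -
  let ?R = "plane_rot i j \<theta>" and ?T = "\<lambda>y. vscale n (x / vnorm n y) y" and ?U = "unit_ball_uniform n"
  have T: "?T \<in> borel_vec n \<rightarrow>\<^sub>M borel_vec n" by measurable
  have R: "?R \<in> ?U \<rightarrow>\<^sub>M borel_vec n"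
    using measurable_plane_rot[OF assms(1,2)] sets_unit_ball_uniform[of n]
    by (simp cong: measurable_cong_sets)
  have "distr (sphere_uniform n x) (borel_vec n) ?R = distr ?U (borel_vec n) (?R \<circ> ?T)"
    unfolding sphere_uniform_def
    by (rule distr_distr[OF measurable_plane_rot[OF assms(1,2)] measurable_normalise])
  also have "?R \<circ> ?T = ?T \<circ> ?R"
    using plane_rot_vscale plane_rot_vnorm assms by (auto simp: fun_eq_iff)
  also have "distr ?U (borel_vec n) \<dots> = distr (distr ?U (borel_vec n) ?R) (borel_vec n) ?T"
    by (rule distr_distr[symmetric, OF T R])
  also have "\<dots> = sphere_uniform n x"
    unfolding distr_unit_ball_uniform_plane_rot[OF assms] sphere_uniform_def ..
  finally show ?thesis .
qed

lemma integrable_sphere_uniform: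
  fixes f :: "(nat \<Rightarrow> real) \<Rightarrow> real"
  assumes "n \<ge> 1" "x \<ge> 0" and f: "f \<in> borel_measurable (borel_vec n)"
    and bd: "\<And>y. vnorm n y = x \<Longrightarrow> \<bar>f y\<bar> \<le> K"
  shows "integrable (sphere_uniform n x) f"
proof -
  interpret prob_space "sphere_uniform n x" using assms by (intro prob_space_sphere_uniform)
  show ?thesis
  proof (rule integrable_const_bound)
    show "AE y in sphere_uniform n x. norm (f y) \<le> K"
      using AE_sphere_uniform_vnorm[OF assms(1,2)] by eventually_elim (use bd in auto)
  qed (use f in \<open>simp cong: measurable_cong_sets add: sets_sphere_uniform\<close>)
qed

lemma sphere_uniform_integrable_vinner:
  fixes g :: "real \<Rightarrow> real"
  assumes n: "n \<ge> 1" and x: "x \<ge> 0" and g: "continuous_on UNIV g"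
  shows "integrable (sphere_uniform n x) (\<lambda>y. g (vinner n l y))"
proof -
  define A where "A = vnorm n l * x"
  have "bounded (g ` {-A..A})"
    by (intro compact_imp_bounded compact_continuous_image continuous_on_subset[OF g]) auto
  then obtain K where K: "\<And>v. v \<in> {-A..A} \<Longrightarrow> \<bar>g v\<bar> \<le> K"
    unfolding bounded_iff by force
  show ?thesis
  proof (rule integrable_sphere_uniform[OF n x])
    have [measurable]: "g \<in> borel_measurable borel" using g by (rule borel_measurable_continuous_onI)
    show "(\<lambda>y. g (vinner n l y)) \<in> borel_measurable (borel_vec n)" by measurable
    show "\<bar>g (vinner n l y)\<bar> \<le> K" if "vnorm n y = x" for y
      using abs_vinner_le[of n l y] that by (intro K) (auto simp: A_def abs_le_iff)
  qed
qed

section \<open>Integration by parts on the sphere\<close>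

text \<open>
  The function \<open>G\<close> is the derivative at angle \<open>0\<close> of \<open>y j * \<phi> (vinner n l y)\<close> along the rotation in the
  \<open>(i, j)\<close>-plane.  Rotation invariance makes the integral of every difference quotient vanish, and
  dominated convergence carries this over to the derivative.
\<close>

lemma sphere_uniform_rotation_generator:
  fixes \<phi> \<phi>' :: "real \<Rightarrow> real" and l :: "nat \<Rightarrow> real"
  assumes ij: "i < n" "j < n" "i \<noteq> j" and x: "x \<ge> 0"
    and d: "\<And>v. (\<phi> has_real_derivative \<phi>' v) (at v)" and c: "continuous_on UNIV \<phi>'"
  defines "G \<equiv> (\<lambda>y. y i * \<phi> (vinner n l y) + y j * (l j * y i - l i * y j) * \<phi>' (vinner n l y))"
  shows "integrable (sphere_uniform n x) G" "(\<integral>y. G y \<partial>sphere_uniform n x) = 0"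
proof -
  let ?S = "sphere_uniform n x"
  have n: "n \<ge> 1" using ij by simp
  define F where "F = (\<lambda>y. y j * \<phi> (vinner n l y))"
  define A where "A = vnorm n l * x"
  have c0: "continuous_on UNIV \<phi>" using d by (meson DERIV_continuous_on DERIV_subset subset_UNIV)
  have "bounded (\<phi> ` {-A..A} \<union> \<phi>' ` {-A..A})"
    by (intro bounded_Un[THEN iffD2] conjI compact_imp_bounded compact_continuous_image
        continuous_on_subset[OF c0] continuous_on_subset[OF c]) auto
  then obtain K where K: "\<And>v. v \<in> {-A..A} \<Longrightarrow> \<bar>\<phi> v\<bar> \<le> K" "\<And>v. v \<in> {-A..A} \<Longrightarrow> \<bar>\<phi>' v\<bar> \<le> K"
    unfolding bounded_iff by force
  define D where "D = x * K + x * (2 * vnorm n l * x) * K"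
  have bF: "\<bar>F y\<bar> \<le> x * K" and bG: "\<bar>G y\<bar> \<le> D" if y: "vnorm n y = x" for y
  proof -
    have v: "vinner n l y \<in> {-A..A}"
      using abs_vinner_le[of n l y] y by (auto simp: A_def abs_le_iff)
    have yb: "\<bar>y i\<bar> \<le> x" "\<bar>y j\<bar> \<le> x" "\<bar>l i\<bar> \<le> vnorm n l" "\<bar>l j\<bar> \<le> vnorm n l"
      using abs_component_le_vnorm ij y by metis+
    show "\<bar>F y\<bar> \<le> x * K"
      unfolding F_def abs_mult using yb K[OF v] x by (intro mult_mono) auto
    have "\<bar>y i * \<phi> (vinner n l y)\<bar> \<le> x * K"
      unfolding abs_mult using yb K[OF v] x by (intro mult_mono) auto
    moreover have "\<bar>l j * y i - l i * y j\<bar> \<le> 2 * vnorm n l * x"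
    proof -
      have "\<bar>l j * y i\<bar> \<le> vnorm n l * x" "\<bar>l i * y j\<bar> \<le> vnorm n l * x"
        unfolding abs_mult using yb by (intro mult_mono; simp add: vnorm_nonneg)+
      then show ?thesis by linarith
    qed
    then have "\<bar>y j * (l j * y i - l i * y j) * \<phi>' (vinner n l y)\<bar> \<le> x * (2 * vnorm n l * x) * K"
      unfolding abs_mult using yb K[OF v] x vnorm_nonneg[of n l] by (intro mult_mono) auto
    ultimately show "\<bar>G y\<bar> \<le> D" unfolding G_def D_def by linarith
  qed
  have mc: "(\<lambda>y. y k) \<in> borel_measurable (borel_vec n)" if "k < n" for k
    using that by (intro measurable_component_singleton) auto
  have mphi: "\<phi> \<in> borel_measurable borel" "\<phi>' \<in> borel_measurable borel"
    using c0 c by (auto intro: borel_measurable_continuous_onI)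
  have mF: "F \<in> borel_measurable (borel_vec n)" and mG: "G \<in> borel_measurable (borel_vec n)"
    unfolding F_def G_def using mc[OF ij(1)] mc[OF ij(2)] mphi[THEN measurable_compose[OF measurable_vinner_const]]
    by (auto intro!: borel_measurable_times borel_measurable_add borel_measurable_diff)
  show iG: "integrable ?S G" by (rule integrable_sphere_uniform[OF n x mG bG])
  let ?R = "plane_rot i j"
  have mR: "?R \<theta> \<in> borel_vec n \<rightarrow>\<^sub>M borel_vec n" for \<theta> by (rule measurable_plane_rot[OF ij(1,2)])
  have deriv: "((\<lambda>\<theta>. F (?R \<theta> y)) has_real_derivative G (?R \<theta> y)) (at \<theta>)" for y \<theta>
  proof -
    have j': "?R \<theta> y j = sin \<theta> * y i + cos \<theta> * y j" "?R \<theta> y i = cos \<theta> * y i - sin \<theta> * y j" for \<theta>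
      using ij by (auto simp: plane_rot_def)
    show ?thesis unfolding F_def G_def j' plane_rot_vinner[OF ij]
      by (auto intro!: derivative_eq_intros DERIV_chain2[OF d] simp: algebra_simps)
  qed
  have R0: "?R 0 y = y" for y by (auto simp: plane_rot_def fun_eq_iff)
  \<comment> \<open>Only small positive angles are used, so that \<open>sin \<theta> \<noteq> 0\<close> and the rotation is a product of shears.\<close>
  define \<tau> where "\<tau> k = 1 / real (Suc k)" for k
  have \<tau>: "0 < \<tau> k" "\<tau> k \<le> 1" for k by (auto simp: \<tau>_def)
  have sin: "sin (\<tau> k) \<noteq> 0" for k using sin_gt_zero[of "\<tau> k"] \<tau>[of k] pi_gt3 by auto
  have lim\<tau>: "\<tau> \<longlonglongrightarrow> 0" unfolding \<tau>_def by (rule LIMSEQ_Suc[OF lim_1_over_n])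
  define s where "s k y = (F (?R (\<tau> k) y) - F y) / \<tau> k" for k y
  have int0: "(\<integral>y. s k y \<partial>?S) = 0" for k
  proof -
    have FR: "(\<lambda>y. F (?R (\<tau> k) y)) \<in> borel_measurable (borel_vec n)"
      by (rule measurable_compose[OF mR mF])
    have i1: "integrable ?S (\<lambda>y. F (?R (\<tau> k) y))" "integrable ?S F"
      by (rule integrable_sphere_uniform[OF n x FR bF] integrable_sphere_uniform[OF n x mF bF];
          simp add: plane_rot_vnorm[OF ij])+
    have "(\<integral>y. F (?R (\<tau> k) y) \<partial>?S) = (\<integral>y. F y \<partial>distr ?S (borel_vec n) (?R (\<tau> k)))"
      by (rule integral_distr[symmetric, OF _ mF])
        (use mR in \<open>simp cong: measurable_cong_sets add: sets_sphere_uniform\<close>)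
    also have "\<dots> = (\<integral>y. F y \<partial>?S)" by (simp add: distr_sphere_uniform_plane_rot[OF ij sin])
    finally show ?thesis unfolding s_def using i1 by simp
  qed
  \<comment> \<open>By the mean value theorem each difference quotient is a value of \<open>G\<close> on the same sphere,
    hence dominated by \<open>D\<close>.\<close>
  have "(\<lambda>k. \<integral>y. s k y \<partial>?S) \<longlonglongrightarrow> (\<integral>y. G y \<partial>?S)"
  proof (rule integral_dominated_convergence[where w = "\<lambda>_. D"])
    interpret prob_space ?S using n by (intro prob_space_sphere_uniform)
    show "G \<in> borel_measurable ?S"
      using mG by (simp cong: measurable_cong_sets add: sets_sphere_uniform)
    show "s k \<in> borel_measurable ?S" for k
    proof -
      have "s k \<in> borel_measurable (borel_vec n)" unfolding s_def
        using measurable_compose[OF mR mF] mF by (intro borel_measurable_divide borel_measurable_diff) auto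
      then show ?thesis by (simp cong: measurable_cong_sets add: sets_sphere_uniform)
    qed
    show "integrable ?S (\<lambda>_. D)" by simp
    show "AE y in ?S. (\<lambda>k. s k y) \<longlonglongrightarrow> G y"
    proof (rule AE_I2)
      fix y
      have "((\<lambda>h. (F (?R h y) - F y) / h) \<longlongrightarrow> G y) (at 0)"
        using deriv[of y 0] by (simp add: DERIV_def R0)
      moreover have "filterlim \<tau> (at 0) sequentially"
        unfolding filterlim_at using lim\<tau> \<tau>(1) by (auto simp: less_imp_neq[symmetric] intro!: always_eventually)
      ultimately show "(\<lambda>k. s k y) \<longlonglongrightarrow> G y"
        unfolding s_def by (rule filterlim_compose)
    qed
    show "AE y in ?S. norm (s k y) \<le> D" for k
      using AE_sphere_uniform_vnorm[OF n x]
    proof eventually_elim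
      case (elim y)
      obtain z where z: "F (?R (\<tau> k) y) - F (?R 0 y) = (\<tau> k - 0) * G (?R z y)"
        using MVT2[OF \<tau>(1)[of k] deriv[of y]] by blast
      have "s k y = G (?R z y)" using z \<tau>(1)[of k] by (simp add: s_def R0)
      then show ?case using bG[of "?R z y"] elim plane_rot_vnorm[OF ij] by simp
    qed
  qed
  then show "(\<integral>y. G y \<partial>?S) = 0" using int0 by (simp add: LIMSEQ_const_iff)
qed

text \<open>
  Integration by parts on the sphere for functions of \<open>v = vinner n l y\<close>: with respect to the
  spherical Laplacian \<open>\<Delta>\<close>, one has \<open>\<Delta> v = - (n - 1) v / x\<^sup>2\<close> and the squared spherical gradient of \<open>v\<close> is
  \<open>\<parallel>l\<parallel>\<^sup>2 - v\<^sup>2 / x\<^sup>2\<close>.  The formula is the sum over all \<open>i \<noteq> j\<close> of the identities above with weights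
  \<open>l i\<close>; in this form it also covers \<open>x = 0\<close>.
\<close>

lemma sphere_uniform_stein:
  fixes \<phi> \<phi>' :: "real \<Rightarrow> real"
  assumes n: "n \<ge> 1" and x: "x \<ge> 0"
    and d: "\<And>v. (\<phi> has_real_derivative \<phi>' v) (at v)" and c: "continuous_on UNIV \<phi>'"
  shows "(\<integral>y. (real n - 1) * vinner n l y * \<phi> (vinner n l y)
      + ((vinner n l y)\<^sup>2 - (vnorm n l)\<^sup>2 * x\<^sup>2) * \<phi>' (vinner n l y) \<partial>sphere_uniform n x) = 0"
proof -
  let ?S = "sphere_uniform n x" and ?v = "vinner n l"
  let ?G = "\<lambda>i j y. y i * \<phi> (?v y) + y j * (l j * y i - l i * y j) * \<phi>' (?v y)"
  have G: "integrable ?S (?G i j)" "(\<integral>y. ?G i j y \<partial>?S) = 0" if "i < n" "j \<in> {..<n} - {i}" for i j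
    using that sphere_uniform_rotation_generator[OF _ _ _ x d c, of i n j l] by auto
  have "(\<integral>y. (\<Sum>i<n. \<Sum>j\<in>{..<n} - {i}. l i * ?G i j y) \<partial>?S)
      = (\<Sum>i<n. \<Sum>j\<in>{..<n} - {i}. l i * (\<integral>y. ?G i j y \<partial>?S))"
  proof -
    have "(\<integral>y. (\<Sum>j\<in>{..<n} - {i}. l i * ?G i j y) \<partial>?S)
        = (\<Sum>j\<in>{..<n} - {i}. l i * (\<integral>y. ?G i j y \<partial>?S))" if "i < n" for i
    proof (subst Bochner_Integration.integral_sum)
      show "integrable ?S (\<lambda>y. l i * ?G i j y)" if "j \<in> {..<n} - {i}" for j
        by (intro integrable_mult_right G(1) that \<open>i < n\<close>)
    qed (simp only: integral_mult_right_zero)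
    then show ?thesis
      by (subst Bochner_Integration.integral_sum)
        (auto intro!: Bochner_Integration.integrable_sum integrable_mult_right G(1) sum.cong)
  qed
  also have "\<dots> = 0" using G(2) by (intro sum.neutral) auto
  finally have *: "(\<integral>y. (\<Sum>i<n. \<Sum>j\<in>{..<n} - {i}. l i * ?G i j y) \<partial>?S) = 0" .
  have pt: "(\<Sum>i<n. \<Sum>j\<in>{..<n} - {i}. l i * ?G i j y) =
      (real n - 1) * ?v y * \<phi> (?v y) + ((?v y)\<^sup>2 - (vnorm n l)\<^sup>2 * (vnorm n y)\<^sup>2) * \<phi>' (?v y)" for y
  proof -
    have "(\<Sum>j\<in>{..<n} - {i}. l i * ?G i j y) = (real n - 1) * (l i * y i) * \<phi> (?v y)
       + (\<Sum>j<n. (l i * y i) * (l j * y j) - (l i)\<^sup>2 * (y j)\<^sup>2) * \<phi>' (?v y)" if "i < n" for i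
    proof -
      \<comment> \<open>the term with \<open>j = i\<close> vanishes, so the sum may run over all \<open>j\<close>\<close>
      have "(\<Sum>j<n. (l i * y i) * (l j * y j) - (l i)\<^sup>2 * (y j)\<^sup>2)
          = (\<Sum>j\<in>{..<n} - {i}. (l i * y i) * (l j * y j) - (l i)\<^sup>2 * (y j)\<^sup>2)"
        using that by (simp add: sum.remove[of "{..<n}" i] power2_eq_square)
      moreover have "(\<Sum>j\<in>{..<n} - {i}. l i * ?G i j y) = (\<Sum>j\<in>{..<n} - {i}. l i * y i * \<phi> (?v y))
          + (\<Sum>j\<in>{..<n} - {i}. (l i * y i) * (l j * y j) - (l i)\<^sup>2 * (y j)\<^sup>2) * \<phi>' (?v y)"
        unfolding sum_distrib_right sum.distrib[symmetric]
        by (intro sum.cong) (auto simp: algebra_simps power2_eq_square)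
      ultimately show ?thesis using that by (simp add: of_nat_diff)
    qed
    then have "(\<Sum>i<n. \<Sum>j\<in>{..<n} - {i}. l i * ?G i j y) =
       (\<Sum>i<n. (real n - 1) * (l i * y i) * \<phi> (?v y)
       + (\<Sum>j<n. (l i * y i) * (l j * y j) - (l i)\<^sup>2 * (y j)\<^sup>2) * \<phi>' (?v y))"
      by (intro sum.cong) auto
    also have "\<dots> = (real n - 1) * ?v y * \<phi> (?v y)
       + ((\<Sum>i<n. \<Sum>j<n. (l i * y i) * (l j * y j)) - (\<Sum>i<n. \<Sum>j<n. (l i)\<^sup>2 * (y j)\<^sup>2)) * \<phi>' (?v y)"
      unfolding sum.distrib sum_subtractf[symmetric] vinner_def
      by (simp only: sum_distrib_left sum_distrib_right)
    finally show ?thesis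
      unfolding vnorm_power2 sum_product[symmetric] vinner_def by (simp only: power2_eq_square)
  qed
  have mm: "(\<lambda>y. (real n - 1) * ?v y * \<phi> (?v y) + ((?v y)\<^sup>2 - (vnorm n l)\<^sup>2 * z y) * \<phi>' (?v y))
     \<in> borel_measurable ?S" if [measurable]: "z \<in> borel_measurable (borel_vec n)" for z
  proof -
    have [measurable]: "\<phi> \<in> borel_measurable borel" "\<phi>' \<in> borel_measurable borel"
      using d c by (auto intro!: borel_measurable_continuous_onI intro: DERIV_continuous_on DERIV_subset)
    show ?thesis by measurable
  qed
  have "(\<integral>y. (real n - 1) * ?v y * \<phi> (?v y) + ((?v y)\<^sup>2 - (vnorm n l)\<^sup>2 * x\<^sup>2) * \<phi>' (?v y) \<partial>?S)
     = (\<integral>y. (real n - 1) * ?v y * \<phi> (?v y) + ((?v y)\<^sup>2 - (vnorm n l)\<^sup>2 * (vnorm n y)\<^sup>2) * \<phi>' (?v y) \<partial>?S)"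
  proof (rule integral_cong_AE)
    show "AE y in ?S. (real n - 1) * ?v y * \<phi> (?v y) + ((?v y)\<^sup>2 - (vnorm n l)\<^sup>2 * x\<^sup>2) * \<phi>' (?v y) =
      (real n - 1) * ?v y * \<phi> (?v y) + ((?v y)\<^sup>2 - (vnorm n l)\<^sup>2 * (vnorm n y)\<^sup>2) * \<phi>' (?v y)"
      using AE_sphere_uniform_vnorm[OF n x] by eventually_elim auto
  qed (rule mm; measurable)+
  also have "\<dots> = 0" using * unfolding pt .
  finally show ?thesis .
qed

section \<open>Concentration of the tilted distribution\<close>

definition tilt_const :: "nat \<Rightarrow> real \<Rightarrow> (nat \<Rightarrow> real) \<Rightarrow> real" where
  "tilt_const n x l = (\<integral>y. exp (vinner n l y) \<partial>sphere_uniform n x)"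

lemma sphere_tilted_eq:
  "sphere_tilted n x l = density (sphere_uniform n x) (\<lambda>y. ennreal (exp (vinner n l y) / tilt_const n x l))"
  by (simp add: sphere_tilted_def tilt_const_def Let_def)

text \<open>
  By the Cauchy-Schwarz inequality the integrand is bounded below by a positive constant on the sphere.
\<close>

lemma tilt_const_pos:
  assumes n: "n \<ge> 1" and x: "x \<ge> 0"
  shows "tilt_const n x l > 0"
proof -
  interpret prob_space "sphere_uniform n x" using n by (rule prob_space_sphere_uniform)
  have "exp (- (vnorm n l * x)) = (\<integral>y. exp (- (vnorm n l * x)) \<partial>sphere_uniform n x)" 
    by (simp add: prob_space)
  also have "\<dots> \<le> tilt_const n x l" unfolding tilt_const_def
  proof (rule integral_mono_AE)
    show "integrable (sphere_uniform n x) (\<lambda>y. exp (vinner n l y))"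
      by (rule sphere_uniform_integrable_vinner[OF n x]) (intro continuous_intros)
    show "AE y in sphere_uniform n x. exp (- (vnorm n l * x)) \<le> exp (vinner n l y)"
      using AE_sphere_uniform_vnorm[OF n x]
    proof eventually_elim
      case (elim y)
      then show ?case using abs_vinner_le[of n l y] by simp
    qed
  qed simp
  finally show ?thesis using exp_gt_zero less_le_trans by blast
qed

lemma nn_integral_sphere_tilted:
  fixes g :: "real \<Rightarrow> real"
  assumes n: "n \<ge> 1" and x: "x \<ge> 0" and g: "continuous_on UNIV g" "\<And>v. g v \<ge> 0"
  shows "(\<integral>\<^sup>+y. ennreal (g (vinner n l y)) \<partial>sphere_tilted n x (vscale n c l)) =
     ennreal ((\<integral>y. exp (c * vinner n l y) * g (vinner n l y) \<partial>sphere_uniform n x)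
       / tilt_const n x (vscale n c l))"
proof -
  let ?Z = "tilt_const n x (vscale n c l)"
  have Z: "?Z > 0" using tilt_const_pos[OF n x] .
  have [measurable]: "g \<in> borel_measurable borel" using g(1) by (rule borel_measurable_continuous_onI)
  have "(\<integral>\<^sup>+y. ennreal (g (vinner n l y)) \<partial>sphere_tilted n x (vscale n c l)) =
    (\<integral>\<^sup>+y. ennreal (exp (c * vinner n l y) / ?Z) * ennreal (g (vinner n l y)) \<partial>sphere_uniform n x)"
    unfolding sphere_tilted_eq vinner_vscale by (rule nn_integral_density) measurable
  also have "\<dots> = (\<integral>\<^sup>+y. ennreal (exp (c * vinner n l y) * g (vinner n l y) / ?Z) \<partial>sphere_uniform n x)"
    using Z g(2) by (intro nn_integral_cong) (simp add: ennreal_mult'[symmetric])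
  also have "\<dots> = ennreal (\<integral>y. exp (c * vinner n l y) * g (vinner n l y) / ?Z \<partial>sphere_uniform n x)"
  proof (rule nn_integral_eq_integral)
    have "continuous_on UNIV (\<lambda>v. exp (c * v) * g v / ?Z)"
      using Z by (intro continuous_intros g(1)) auto
    from sphere_uniform_integrable_vinner[OF n x this]
    show "integrable (sphere_uniform n x) (\<lambda>y. exp (c * vinner n l y) * g (vinner n l y) / ?Z)" .
  qed (use Z g(2) in auto)
  finally show ?thesis by simp
qed

lemma AE_sphere_tilted_vnorm:
  assumes n: "n \<ge> 1" and x: "x \<ge> 0"
  shows "AE y in sphere_tilted n x l. vnorm n y = x"
  unfolding sphere_tilted_eq using AE_sphere_uniform_vnorm[OF n x]
  by (subst AE_density) auto

text \<open>
  The larger root of \<open>v\<^sup>2 + 2 v - a\<^sup>2\<close>, near which the inner product of \<open>l\<close> with the tilted random point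
  concentrates.
\<close>

definition tilt_root :: "real \<Rightarrow> real" where
  "tilt_root a = sqrt (1 + a\<^sup>2) - 1"

text \<open>
  The quadratic factors into \<open>v - tilt_root a\<close> and \<open>v + 1 + sqrt (1 + a\<^sup>2)\<close>, and on \<open>[-a, a]\<close> the second factor
  is at least \<open>1\<close>.
\<close>

lemma tilt_root_gap:
  assumes "\<bar>v\<bar> \<le> a"
  shows "(v - tilt_root a)\<^sup>2 \<le> (v\<^sup>2 + 2 * v - a\<^sup>2)\<^sup>2"
proof -
  have s: "(sqrt (1 + a\<^sup>2))\<^sup>2 = 1 + a\<^sup>2" by (simp add: add_nonneg_nonneg)
  have "a \<le> sqrt (1 + a\<^sup>2)" by (rule real_le_rsqrt) simp
  then have "1 \<le> v + 1 + sqrt (1 + a\<^sup>2)" using assms by linarith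
  then have "1 \<le> (v + 1 + sqrt (1 + a\<^sup>2))\<^sup>2" by simp
  then have "(v - tilt_root a)\<^sup>2 * 1 \<le> (v - tilt_root a)\<^sup>2 * (v + 1 + sqrt (1 + a\<^sup>2))\<^sup>2"
    by (intro mult_left_mono) auto
  also have "\<dots> = (v\<^sup>2 + 2 * v - a\<^sup>2)\<^sup>2"
  proof -
    have "(v - tilt_root a) * (v + 1 + sqrt (1 + a\<^sup>2)) = (v + 1)\<^sup>2 - (sqrt (1 + a\<^sup>2))\<^sup>2"
      by (simp add: tilt_root_def power2_eq_square algebra_simps)
    then have "(v - tilt_root a) * (v + 1 + sqrt (1 + a\<^sup>2)) = v\<^sup>2 + 2 * v - a\<^sup>2"
      unfolding s by (simp add: power2_eq_square algebra_simps)
    then show ?thesis by (metis power_mult_distrib)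
  qed
  finally show ?thesis by simp
qed

text \<open>
  The integration by parts formula is applied to \<open>\<phi> v = q v * exp (c * v)\<close> with \<open>q v = v\<^sup>2 + 2 * v - a\<^sup>2\<close> and
  \<open>c = (n - 1) / 2\<close>.  This \<open>q\<close> is the drift that the weight \<open>exp (c * v)\<close> induces on \<open>v\<close>, up to the factor
  \<open>- c / x\<^sup>2\<close> if \<open>x > 0\<close>, so the formula computes the second moment of \<open>q\<close> under the tilted distribution.
\<close>

lemma sphere_tilted_variance:
  fixes l :: "nat \<Rightarrow> real"
  assumes n: "n \<ge> 2" and x: "x \<ge> 0"
  defines "a \<equiv> vnorm n l * x"
  shows "(\<integral>\<^sup>+y. ennreal ((vinner n l y - tilt_root a)\<^sup>2)
      \<partial>sphere_tilted n x (vscale n ((real n - 1) / 2) l)) \<le> ennreal (4 * a\<^sup>2 * (a + 1) / (real n - 1))"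
proof -
  have n1: "n \<ge> 1" using n by simp
  let ?S = "sphere_uniform n x" and ?v = "vinner n l"
  define c where "c = (real n - 1) / 2"
  have c: "c > 0" "real n - 1 = 2 * c" using n by (auto simp: c_def)
  let ?Z = "tilt_const n x (vscale n c l)"
  let ?q = "\<lambda>v. v\<^sup>2 + 2 * v - a\<^sup>2"
  have Z: "?Z > 0" using tilt_const_pos[OF n1 x] .
  have Zeq: "?Z = (\<integral>y. exp (c * ?v y) \<partial>?S)" by (simp add: tilt_const_def vinner_vscale)
  have a0: "a \<ge> 0" using x vnorm_nonneg by (simp add: a_def)
  note int = sphere_uniform_integrable_vinner[OF n1 x]
  have va: "AE y in ?S. \<bar>?v y\<bar> \<le> a"
    using AE_sphere_uniform_vnorm[OF n1 x] by eventually_elim (use abs_vinner_le[of n l] in \<open>auto simp: a_def\<close>)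
  have i1: "integrable ?S (\<lambda>y. exp (c * ?v y) * (?q (?v y))\<^sup>2)"
    and i2: "integrable ?S (\<lambda>y. exp (c * ?v y) * ((a\<^sup>2 - (?v y)\<^sup>2) * (2 * ?v y + 2)))"
    and i3: "integrable ?S (\<lambda>y. exp (c * ?v y) * (2 * a\<^sup>2 * (a + 1)))"
    and i4: "integrable ?S (\<lambda>y. exp (c * ?v y) * (?v y - tilt_root a)\<^sup>2)"
    by (rule int; intro continuous_intros)+
  \<comment> \<open>\<open>real n - 1 = 2 c\<close> makes the terms without a derivative of \<open>q\<close> add up to \<open>c q\<^sup>2\<close> times the
    exponential weight.\<close>
  have "(\<integral>y. (real n - 1) * ?v y * (?q (?v y) * exp (c * ?v y)) + ((?v y)\<^sup>2 - (vnorm n l)\<^sup>2 * x\<^sup>2) *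
     ((2 * ?v y + 2) * exp (c * ?v y) + ?q (?v y) * (c * exp (c * ?v y))) \<partial>?S) = 0"
    by (rule sphere_uniform_stein[OF n1 x, of "\<lambda>v. ?q v * exp (c * v)"])
      (auto intro!: derivative_eq_intros continuous_intros simp: algebra_simps)
  also have "(\<lambda>y. (real n - 1) * ?v y * (?q (?v y) * exp (c * ?v y)) + ((?v y)\<^sup>2 - (vnorm n l)\<^sup>2 * x\<^sup>2) *
     ((2 * ?v y + 2) * exp (c * ?v y) + ?q (?v y) * (c * exp (c * ?v y))))
    = (\<lambda>y. c * (exp (c * ?v y) * (?q (?v y))\<^sup>2) - exp (c * ?v y) * ((a\<^sup>2 - (?v y)\<^sup>2) * (2 * ?v y + 2)))"
    unfolding c(2) a_def by (rule ext) algebra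
  finally have "c * (\<integral>y. exp (c * ?v y) * (?q (?v y))\<^sup>2 \<partial>?S)
      = (\<integral>y. exp (c * ?v y) * ((a\<^sup>2 - (?v y)\<^sup>2) * (2 * ?v y + 2)) \<partial>?S)"
    using i1 i2 by (simp add: mult.assoc)
  also have "\<dots> \<le> (\<integral>y. exp (c * ?v y) * (2 * a\<^sup>2 * (a + 1)) \<partial>?S)"
  proof (rule integral_mono_AE[OF i2 i3])
    show "AE y in ?S. exp (c * ?v y) * ((a\<^sup>2 - (?v y)\<^sup>2) * (2 * ?v y + 2)) \<le> exp (c * ?v y) * (2 * a\<^sup>2 * (a + 1))"
      using va
    proof eventually_elim
      case (elim y)
      have "(?v y)\<^sup>2 \<le> a\<^sup>2" using elim by (simp add: abs_le_square_iff[symmetric])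
      then have "(a\<^sup>2 - (?v y)\<^sup>2) * (2 * ?v y + 2) \<le> (a\<^sup>2 - (?v y)\<^sup>2) * (2 * a + 2)"
        using elim by (intro mult_left_mono) auto
      also have "\<dots> \<le> a\<^sup>2 * (2 * a + 2)" using a0 by (intro mult_right_mono) auto
      finally show ?case by (intro mult_left_mono) (auto simp: algebra_simps)
    qed
  qed
  also have "\<dots> = 2 * a\<^sup>2 * (a + 1) * ?Z" unfolding Zeq by simp
  finally have q2: "(\<integral>y. exp (c * ?v y) * (?q (?v y))\<^sup>2 \<partial>?S) / ?Z \<le> 2 * a\<^sup>2 * (a + 1) / c"
    using c(1) Z by (simp add: field_simps)
  have "(\<integral>y. exp (c * ?v y) * (?v y - tilt_root a)\<^sup>2 \<partial>?S) \<le> (\<integral>y. exp (c * ?v y) * (?q (?v y))\<^sup>2 \<partial>?S)"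
  proof (rule integral_mono_AE[OF i4 i1])
    show "AE y in ?S. exp (c * ?v y) * (?v y - tilt_root a)\<^sup>2 \<le> exp (c * ?v y) * (?q (?v y))\<^sup>2"
      using va by eventually_elim (intro mult_left_mono tilt_root_gap; simp)
  qed
  then have "(\<integral>y. exp (c * ?v y) * (?v y - tilt_root a)\<^sup>2 \<partial>?S) / ?Z
     \<le> (\<integral>y. exp (c * ?v y) * (?q (?v y))\<^sup>2 \<partial>?S) / ?Z"
    using Z by (simp add: divide_right_mono)
  also note q2
  finally have "(\<integral>y. exp (c * ?v y) * (?v y - tilt_root a)\<^sup>2 \<partial>?S) / ?Z \<le> 4 * a\<^sup>2 * (a + 1) / (real n - 1)"
    unfolding c(2) by (simp add: mult_ac)
  moreover have "(\<integral>\<^sup>+y. ennreal ((?v y - tilt_root a)\<^sup>2) \<partial>sphere_tilted n x (vscale n c l))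
     = ennreal ((\<integral>y. exp (c * ?v y) * (?v y - tilt_root a)\<^sup>2 \<partial>?S) / ?Z)"
    by (rule nn_integral_sphere_tilted[OF n1 x]) (auto intro!: continuous_intros)
  ultimately show ?thesis unfolding c_def by (simp add: ennreal_leI)
qed

section \<open>Second moments of Gaussian vectors and of Brownian motion\<close>

lemma normal_density_moments:
  assumes \<sigma>: "\<sigma> > 0"
  defines "\<nu> \<equiv> density lborel (\<lambda>z. ennreal (normal_density 0 \<sigma> z))"
  shows "prob_space \<nu>" "integrable \<nu> (\<lambda>z. z ^ k)"
    "(\<integral>z. z \<partial>\<nu>) = 0" "(\<integral>z. z\<^sup>2 \<partial>\<nu>) = \<sigma>\<^sup>2" "(\<integral>z. z ^ 4 \<partial>\<nu>) = 3 * \<sigma> ^ 4"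
proof -
  show "prob_space \<nu>" unfolding \<nu>_def using \<sigma> by (rule prob_space_normal_density)
  show "integrable \<nu> (\<lambda>z. z ^ k)" unfolding \<nu>_def
    using integrable_normal_moment[OF \<sigma>, of 0 k] by (subst integrable_density) auto
  have int: "(\<integral>z. z ^ m \<partial>\<nu>) = (\<integral>z. normal_density 0 \<sigma> z * z ^ m \<partial>lborel)" for m
    unfolding \<nu>_def by (subst integral_density) auto
  show "(\<integral>z. z \<partial>\<nu>) = 0"
    using int[of 1] integral_normal_moment_nz_1[OF \<sigma>, of 0] by simp
  show "(\<integral>z. z\<^sup>2 \<partial>\<nu>) = \<sigma>\<^sup>2"
    using int[of 2] integral_normal_moment_even[OF \<sigma>, of 0 1] \<sigma> by (simp add: fact_numeral)
  show "(\<integral>z. z ^ 4 \<partial>\<nu>) = 3 * \<sigma> ^ 4"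
    using int[of 4] integral_normal_moment_even[OF \<sigma>, of 0 2] \<sigma>
    by (simp add: fact_numeral power_divide)
qed

text \<open>
  The mixed terms vanish by independence.  Taking \<open>h z = z\<close> gives the second moment of the inner product
  with \<open>c\<close>; taking \<open>h z = z\<^sup>2 - s\<close> and \<open>c = 1\<close> gives the variance of the squared norm of a Gaussian vector.
\<close>

lemma PiM_centered_sum_second_moment:
  fixes h :: "real \<Rightarrow> real" and c :: "'i \<Rightarrow> real"
  assumes I: "finite I" and \<nu>: "prob_space \<nu>"
    and i1: "integrable \<nu> h" and i2: "integrable \<nu> (\<lambda>z. (h z)\<^sup>2)" and h0: "(\<integral>z. h z \<partial>\<nu>) = 0"
  shows "(\<integral>\<^sup>+y. ennreal ((\<Sum>i\<in>I. c i * h (y i))\<^sup>2) \<partial>(\<Pi>\<^sub>M i\<in>I. \<nu>))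
    = ennreal ((\<integral>z. (h z)\<^sup>2 \<partial>\<nu>) * (\<Sum>i\<in>I. (c i)\<^sup>2))"
proof -
  interpret \<nu>: prob_space \<nu> by fact
  interpret product_sigma_finite "\<lambda>_::'i. \<nu>" ..
  let ?M = "\<Pi>\<^sub>M i\<in>I. \<nu>"
  have pair: "integrable ?M (\<lambda>y. h (y i) * h (y j))"
    "(\<integral>y. h (y i) * h (y j) \<partial>?M) = (if i = j then (\<integral>z. (h z)\<^sup>2 \<partial>\<nu>) else 0)"
    if ij: "i \<in> I" "j \<in> I" for i j
  proof -
    \<comment> \<open>one factor for each coordinate: the product of the \<open>f k (y k)\<close> is \<open>h (y i) * h (y j)\<close>\<close>
    define f where "f k = (if k = i \<and> k = j then (\<lambda>z. (h z)\<^sup>2) else if k = i \<or> k = j then h else (\<lambda>_. 1))" for k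
    have int: "integrable \<nu> (f k)" for k using i1 i2 by (auto simp: f_def)
    have pr: "(\<Prod>k\<in>I. f k (y k)) = h (y i) * h (y j)" for y
    proof (cases "i = j")
      case True
      have "(\<Prod>k\<in>I. f k (y k)) = (\<Prod>k\<in>I. if k = i then (h (y i))\<^sup>2 else 1)"
        by (intro prod.cong) (auto simp: f_def True)
      then show ?thesis using I ij True by (simp add: power2_eq_square)
    next
      case False
      have "(\<Prod>k\<in>I. f k (y k)) = (\<Prod>k\<in>I. (if k = i then h (y i) else 1) * (if k = j then h (y j) else 1))"
        using False by (intro prod.cong) (auto simp: f_def)
      then show ?thesis using I ij by (simp add: prod.distrib)
    qed
    show "integrable ?M (\<lambda>y. h (y i) * h (y j))"
      using product_integrable_prod[OF I, where f = f, OF int] by (simp add: pr)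
    have "(\<integral>y. h (y i) * h (y j) \<partial>?M) = (\<Prod>k\<in>I. \<integral>z. f k z \<partial>\<nu>)"
      using product_integral_prod[OF I, where f = f, OF int] by (simp add: pr)
    also have "\<dots> = (if i = j then (\<integral>z. (h z)\<^sup>2 \<partial>\<nu>) else 0)"
    proof (cases "i = j")
      case True
      have "(\<Prod>k\<in>I. \<integral>z. f k z \<partial>\<nu>) = (\<Prod>k\<in>I. if k = i then (\<integral>z. (h z)\<^sup>2 \<partial>\<nu>) else 1)"
        by (intro prod.cong) (auto simp: f_def True \<nu>.prob_space)
      then show ?thesis using I ij True by simp
    next
      case False
      have "(\<integral>z. f i z \<partial>\<nu>) = 0" using False h0 by (simp add: f_def)
      then show ?thesis using I ij False by (auto intro: prod_zero)
    qed
    finally show "(\<integral>y. h (y i) * h (y j) \<partial>?M) = (if i = j then (\<integral>z. (h z)\<^sup>2 \<partial>\<nu>) else 0)" .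
  qed
  have sq: "(\<Sum>i\<in>I. c i * h (y i))\<^sup>2 = (\<Sum>i\<in>I. \<Sum>j\<in>I. c i * c j * (h (y i) * h (y j)))" for y
    unfolding power2_eq_square sum_product by (intro sum.cong) (auto simp: algebra_simps)
  have "integrable ?M (\<lambda>y. (\<Sum>i\<in>I. c i * h (y i))\<^sup>2)"
    unfolding sq by (intro Bochner_Integration.integrable_sum integrable_mult_right pair)
  then have "(\<integral>\<^sup>+y. ennreal ((\<Sum>i\<in>I. c i * h (y i))\<^sup>2) \<partial>?M) = ennreal (\<integral>y. (\<Sum>i\<in>I. c i * h (y i))\<^sup>2 \<partial>?M)"
    by (intro nn_integral_eq_integral) auto
  also have "(\<integral>y. (\<Sum>i\<in>I. c i * h (y i))\<^sup>2 \<partial>?M) = (\<Sum>i\<in>I. \<integral>y. (\<Sum>j\<in>I. c i * c j * (h (y i) * h (y j))) \<partial>?M)"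
    unfolding sq by (intro Bochner_Integration.integral_sum Bochner_Integration.integrable_sum integrable_mult_right pair)
  also have "\<dots> = (\<Sum>i\<in>I. \<Sum>j\<in>I. \<integral>y. c i * c j * (h (y i) * h (y j)) \<partial>?M)"
    by (intro sum.cong Bochner_Integration.integral_sum integrable_mult_right pair) auto
  also have "\<dots> = (\<Sum>i\<in>I. \<Sum>j\<in>I. if i = j then (\<integral>z. (h z)\<^sup>2 \<partial>\<nu>) * (c i)\<^sup>2 else 0)"
    by (intro sum.cong) (auto simp: pair power2_eq_square)
  also have "\<dots> = (\<integral>z. (h z)\<^sup>2 \<partial>\<nu>) * (\<Sum>i\<in>I. (c i)\<^sup>2)"
    using I by (simp add: sum_distrib_left)
  finally show ?thesis .
qed

definition gaussian_vec :: "nat \<Rightarrow> real \<Rightarrow> (nat \<Rightarrow> real) measure" where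
  "gaussian_vec n s = (\<Pi>\<^sub>M i\<in>{..<n}. density lborel (\<lambda>z. ennreal (normal_density 0 (sqrt s) z)))"

lemma gaussian_vec_moments:
  assumes s: "s > 0"
  shows "(\<integral>\<^sup>+g. ennreal ((vinner n c g)\<^sup>2) \<partial>gaussian_vec n s) = ennreal (s * (vnorm n c)\<^sup>2)"
    "(\<integral>\<^sup>+g. ennreal (((vnorm n g)\<^sup>2 - real n * s)\<^sup>2) \<partial>gaussian_vec n s) = ennreal (2 * real n * s\<^sup>2)"
proof -
  let ?\<nu> = "density lborel (\<lambda>z. ennreal (normal_density 0 (sqrt s) z))"
  have \<sigma>: "sqrt s > 0" using s by simp
  note mom = normal_density_moments[OF \<sigma>]
  interpret prob_space ?\<nu> by (rule mom(1))
  show "(\<integral>\<^sup>+g. ennreal ((vinner n c g)\<^sup>2) \<partial>gaussian_vec n s) = ennreal (s * (vnorm n c)\<^sup>2)"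
    using PiM_centered_sum_second_moment[of "{..<n}" ?\<nu> "\<lambda>z. z" c] mom(1,3,4) mom(2)[of 1] mom(2)[of 2] s
    by (simp add: gaussian_vec_def vinner_def vnorm_power2)
  have s4: "sqrt s ^ 4 = s\<^sup>2" using s by (simp add: power4_eq_xxxx power2_eq_square)
  have i2: "integrable ?\<nu> (\<lambda>z. z\<^sup>2 - s)" using mom(2)[of 2] by simp
  have eq: "(z\<^sup>2 - s)\<^sup>2 = z ^ 4 - 2 * s * z\<^sup>2 + s\<^sup>2" for z :: real by algebra
  have i4: "integrable ?\<nu> (\<lambda>z. (z\<^sup>2 - s)\<^sup>2)" unfolding eq using mom(2)[of 2] mom(2)[of 4] by simp
  have e2: "(\<integral>z. z\<^sup>2 - s \<partial>?\<nu>) = 0" using mom(2)[of 2] mom(4) s prob_space by simp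
  have "(\<integral>z. (z\<^sup>2 - s)\<^sup>2 \<partial>?\<nu>) = (\<integral>z. z ^ 4 \<partial>?\<nu>) - 2 * s * (\<integral>z. z\<^sup>2 \<partial>?\<nu>) + s\<^sup>2"
    unfolding eq using mom(2)[of 2] mom(2)[of 4] prob_space by simp
  also have "\<dots> = 2 * s\<^sup>2" using mom(4,5) s by (simp add: s4 power2_eq_square)
  finally have e4: "(\<integral>z. (z\<^sup>2 - s)\<^sup>2 \<partial>?\<nu>) = 2 * s\<^sup>2" .
  have "(vnorm n g)\<^sup>2 - real n * s = (\<Sum>i<n. 1 * ((g i)\<^sup>2 - s))" for g
    by (simp add: vnorm_power2 sum_subtractf)
  then show "(\<integral>\<^sup>+g. ennreal (((vnorm n g)\<^sup>2 - real n * s)\<^sup>2) \<partial>gaussian_vec n s) = ennreal (2 * real n * s\<^sup>2)"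
    using PiM_centered_sum_second_moment[of "{..<n}" ?\<nu> "\<lambda>z. z\<^sup>2 - s" "\<lambda>_. 1", OF _ mom(1) i2 i4 e2] e4
    by (simp add: gaussian_vec_def mult_ac)
qed

lemma brownian_motion_marginal:
  assumes W: "standard_brownian_motion P n W" and s: "s > 0"
  shows "distr P (borel_vec n) (W s) = gaussian_vec n s"
proof -
  interpret prob_space P using W by (simp add: standard_brownian_motion_def)
  have m: "W s \<in> P \<rightarrow>\<^sub>M borel_vec n" "W 0 \<in> P \<rightarrow>\<^sub>M borel_vec n"
    using W s by (auto simp: standard_brownian_motion_def)
  have "AE \<omega> in P. \<forall>i<n. W 0 \<omega> i = 0" using W by (simp add: standard_brownian_motion_def)
  moreover have "AE \<omega> in P. W s \<omega> \<in> extensional {..<n}"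
    using measurable_space[OF m(1)] by (auto simp: space_PiM PiE_iff intro!: AE_I2)
  ultimately have "AE \<omega> in P. W s \<omega> = vadd n (W s \<omega>) (vscale n (-1) (W 0 \<omega>))"
    by eventually_elim (auto simp: vadd_def vscale_def fun_eq_iff extensional_def)
  then have "distr P (borel_vec n) (W s) =
      distr P (borel_vec n) (\<lambda>\<omega>. vadd n (W s \<omega>) (vscale n (-1) (W 0 \<omega>)))"
    using m by (intro distr_cong_AE) auto
  also have "\<dots> = gaussian_vec n s"
  proof -
    have "\<forall>r s. 0 \<le> r \<and> r < s \<longrightarrow>
        distr P (borel_vec n) (\<lambda>\<omega>. vadd n (W s \<omega>) (vscale n (-1) (W r \<omega>))) = gaussian_vec n (s - r)"
      using W unfolding standard_brownian_motion_def gaussian_vec_def by blast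
    from this[rule_format, of 0 s] s show ?thesis by simp
  qed
  finally show ?thesis .
qed

text \<open>
  Time \<open>0\<close> is treated separately: there the path is at the origin almost surely, whereas the normal
  density with standard deviation \<open>0\<close> is the zero function.
\<close>

lemma brownian_motion_moments:
  assumes W: "standard_brownian_motion P n W" and s: "s \<ge> 0"
  shows "(\<integral>\<^sup>+\<omega>. ennreal ((vinner n c (W s \<omega>))\<^sup>2) \<partial>P) = ennreal (s * (vnorm n c)\<^sup>2)"
    "(\<integral>\<^sup>+\<omega>. ennreal (((vnorm n (W s \<omega>))\<^sup>2 - real n * s)\<^sup>2) \<partial>P) = ennreal (2 * real n * s\<^sup>2)"
proof -
  have m: "W s \<in> P \<rightarrow>\<^sub>M borel_vec n" using W s by (auto simp: standard_brownian_motion_def)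
  have d: "(\<integral>\<^sup>+\<omega>. f (W s \<omega>) \<partial>P) = (\<integral>\<^sup>+g. f g \<partial>distr P (borel_vec n) (W s))"
    if "f \<in> borel_measurable (borel_vec n)" for f :: "_ \<Rightarrow> ennreal"
    using m that by (simp add: nn_integral_distr)
  have "(\<integral>\<^sup>+\<omega>. ennreal ((vinner n c (W s \<omega>))\<^sup>2) \<partial>P) = ennreal (s * (vnorm n c)\<^sup>2) \<and>
    (\<integral>\<^sup>+\<omega>. ennreal (((vnorm n (W s \<omega>))\<^sup>2 - real n * s)\<^sup>2) \<partial>P) = ennreal (2 * real n * s\<^sup>2)"
  proof (cases "s = 0")
    case True
    have z: "AE \<omega> in P. \<forall>i<n. W 0 \<omega> i = 0" using W by (simp add: standard_brownian_motion_def)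
    then have "AE \<omega> in P. ennreal ((vinner n c (W s \<omega>))\<^sup>2) = 0"
      by eventually_elim (simp add: True vinner_def)
    moreover from z have "AE \<omega> in P. ennreal (((vnorm n (W s \<omega>))\<^sup>2 - real n * s)\<^sup>2) = 0"
      by eventually_elim (simp add: True vnorm_power2)
    ultimately show ?thesis using True by (simp add: nn_integral_cong_AE[of _ "\<lambda>_. 0"])
  next
    case False
    with s have "s > 0" by simp
    have "(\<integral>\<^sup>+\<omega>. ennreal ((vinner n c (W s \<omega>))\<^sup>2) \<partial>P) = ennreal (s * (vnorm n c)\<^sup>2)"
      by (subst d[of "\<lambda>g. ennreal ((vinner n c g)\<^sup>2)"])
        (measurable, simp only: brownian_motion_marginal[OF W \<open>s > 0\<close>] gaussian_vec_moments(1)[OF \<open>s > 0\<close>])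
    moreover have "(\<integral>\<^sup>+\<omega>. ennreal (((vnorm n (W s \<omega>))\<^sup>2 - real n * s)\<^sup>2) \<partial>P) = ennreal (2 * real n * s\<^sup>2)"
      by (subst d[of "\<lambda>g. ennreal (((vnorm n g)\<^sup>2 - real n * s)\<^sup>2)"])
        (measurable, simp only: brownian_motion_marginal[OF W \<open>s > 0\<close>] gaussian_vec_moments(2)[OF \<open>s > 0\<close>])
    ultimately show ?thesis by simp
  qed
  then show "(\<integral>\<^sup>+\<omega>. ennreal ((vinner n c (W s \<omega>))\<^sup>2) \<partial>P) = ennreal (s * (vnorm n c)\<^sup>2)"
    "(\<integral>\<^sup>+\<omega>. ennreal (((vnorm n (W s \<omega>))\<^sup>2 - real n * s)\<^sup>2) \<partial>P) = ennreal (2 * real n * s\<^sup>2)"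
    by blast+
qed

section \<open>The starting point and the Brownian path\<close>

text \<open>
  By independence the expectation may be taken over \<open>Y\<close> first, with \<open>X\<close> fixed.
\<close>

lemma indep_var_vinner_second_moment:
  assumes P: "prob_space P"
    and ind: "prob_space.indep_var P (borel_vec n) X (borel_vec n) Y"
    and Y: "\<And>c. (\<integral>\<^sup>+\<omega>. ennreal ((vinner n c (Y \<omega>))\<^sup>2) \<partial>P) = ennreal (s * (vnorm n c)\<^sup>2)"
    and X: "AE \<omega> in P. vnorm n (X \<omega>) \<le> K" and s: "s \<ge> 0"
  shows "(\<integral>\<^sup>+\<omega>. ennreal ((vinner n (X \<omega>) (Y \<omega>))\<^sup>2) \<partial>P) \<le> ennreal (s * K\<^sup>2)"
proof -
  interpret prob_space P by fact
  let ?B = "borel_vec n"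
  have m[measurable]: "X \<in> P \<rightarrow>\<^sub>M ?B" "Y \<in> P \<rightarrow>\<^sub>M ?B"
    and joint: "distr P ?B X \<Otimes>\<^sub>M distr P ?B Y = distr P (?B \<Otimes>\<^sub>M ?B) (\<lambda>\<omega>. (X \<omega>, Y \<omega>))"
    using ind unfolding indep_var_distribution_eq by auto
  interpret Y: prob_space "distr P ?B Y" by (rule prob_space_distr) fact
  define f where "f = (\<lambda>p. ennreal ((vinner n (fst p) (snd p))\<^sup>2))"
  have f: "f \<in> borel_measurable (?B \<Otimes>\<^sub>M ?B)"
    unfolding f_def using measurable_vinner[OF measurable_fst measurable_snd]
    by measurable
  have "(\<integral>\<^sup>+\<omega>. ennreal ((vinner n (X \<omega>) (Y \<omega>))\<^sup>2) \<partial>P) = (\<integral>\<^sup>+\<omega>. f (X \<omega>, Y \<omega>) \<partial>P)"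
    by (simp add: f_def)
  also have "\<dots> = (\<integral>\<^sup>+p. f p \<partial>(distr P ?B X \<Otimes>\<^sub>M distr P ?B Y))"
    unfolding joint by (rule nn_integral_distr[symmetric]) (use f in measurable)
  also have "\<dots> = (\<integral>\<^sup>+c. (\<integral>\<^sup>+g. f (c, g) \<partial>distr P ?B Y) \<partial>distr P ?B X)"
    by (rule Y.nn_integral_fst[symmetric]) (use f in \<open>simp cong: measurable_cong_sets\<close>)
  also have "\<dots> = (\<integral>\<^sup>+c. ennreal (s * (vnorm n c)\<^sup>2) \<partial>distr P ?B X)"
  proof (rule nn_integral_cong)
    fix c
    have "(\<lambda>g. f (c, g)) \<in> borel_measurable ?B" unfolding f_def fst_conv snd_conv by measurable
    then have "(\<integral>\<^sup>+g. f (c, g) \<partial>distr P ?B Y) = (\<integral>\<^sup>+\<omega>. f (c, Y \<omega>) \<partial>P)"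
      by (intro nn_integral_distr m) auto
    then show "(\<integral>\<^sup>+g. f (c, g) \<partial>distr P ?B Y) = ennreal (s * (vnorm n c)\<^sup>2)"
      by (simp add: f_def Y)
  qed
  also have "\<dots> = (\<integral>\<^sup>+\<omega>. ennreal (s * (vnorm n (X \<omega>))\<^sup>2) \<partial>P)"
    by (rule nn_integral_distr) measurable
  also have "\<dots> \<le> (\<integral>\<^sup>+\<omega>. ennreal (s * K\<^sup>2) \<partial>P)"
  proof (rule nn_integral_mono_AE)
    show "AE \<omega> in P. ennreal (s * (vnorm n (X \<omega>))\<^sup>2) \<le> ennreal (s * K\<^sup>2)"
      using X by eventually_elim (intro ennreal_leI mult_left_mono power_mono s vnorm_nonneg; simp)
  qed
  also have "\<dots> = ennreal (s * K\<^sup>2)" by (simp add: emeasure_space_1)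
  finally show ?thesis .
qed

text \<open>
  Events about the position at time \<open>s\<close> are particular events about the whole path.
\<close>

lemma indep_set_path_imp_indep_var:
  fixes W :: "real \<Rightarrow> 'a \<Rightarrow> nat \<Rightarrow> real"
  assumes P: "prob_space P" and B0: "B0 \<in> P \<rightarrow>\<^sub>M borel_vec n"
    and W: "\<And>s. s \<ge> 0 \<Longrightarrow> W s \<in> P \<rightarrow>\<^sub>M borel_vec n" and s: "s \<ge> 0"
    and ind: "prob_space.indep_set P {B0 -` A \<inter> space P | A. A \<in> sets (borel_vec n)}
          {(\<lambda>\<omega>. \<lambda>s\<in>{0..}. W s \<omega>) -` A \<inter> space P | A. A \<in> sets (\<Pi>\<^sub>M s\<in>{0..}. borel_vec n)}"
  shows "prob_space.indep_var P (borel_vec n) B0 (borel_vec n) (W s)"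
proof -
  interpret prob_space P by fact
  let ?F = "{(\<lambda>\<omega>. \<lambda>s\<in>{0..}. W s \<omega>) -` A \<inter> space P | A. A \<in> sets (\<Pi>\<^sub>M s\<in>{0..}. borel_vec n)}"
  have sub: "{W s -` A \<inter> space P | A. A \<in> sets (borel_vec n)} \<subseteq> ?F"
  proof safe
    fix A assume A: "A \<in> sets (borel_vec n)"
    let ?C = "(\<lambda>p. p s) -` A \<inter> space (\<Pi>\<^sub>M s\<in>{0..}. borel_vec n)"
    have "(\<lambda>p. p s) \<in> (\<Pi>\<^sub>M s\<in>{0..}. borel_vec n) \<rightarrow>\<^sub>M borel_vec n"
      using s by (intro measurable_component_singleton) auto
    then have "?C \<in> sets (\<Pi>\<^sub>M s\<in>{0..}. borel_vec n)" using A by (rule measurable_sets)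
    moreover have "W s -` A \<inter> space P = (\<lambda>\<omega>. \<lambda>s\<in>{0..}. W s \<omega>) -` ?C \<inter> space P"
    proof -
      have "(\<lambda>s\<in>{0..}. W s \<omega>) \<in> space (\<Pi>\<^sub>M s\<in>{0..}. borel_vec n)" if "\<omega> \<in> space P" for \<omega>
        using measurable_space[OF W that] by (auto simp: space_PiM[of "{0..}"])
      then show ?thesis using s by auto
    qed
    ultimately show "\<exists>C. W s -` A \<inter> space P = (\<lambda>\<omega>. \<lambda>s\<in>{0..}. W s \<omega>) -` C \<inter> space P
        \<and> C \<in> sets (\<Pi>\<^sub>M s\<in>{0..}. borel_vec n)" by blast
  qed
  have "indep_sets (case_bool {B0 -` A \<inter> space P | A. A \<in> sets (borel_vec n)}
      {W s -` A \<inter> space P | A. A \<in> sets (borel_vec n)}) UNIV"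
    by (rule indep_sets_mono_sets[OF ind[unfolded indep_set_def]]) (use sub in \<open>auto split: bool.split\<close>)
  also have "case_bool {B0 -` A \<inter> space P | A. A \<in> sets (borel_vec n)}
      {W s -` A \<inter> space P | A. A \<in> sets (borel_vec n)} =
     (\<lambda>b. {case_bool B0 (W s) b -` A \<inter> space P | A. A \<in> sets (case_bool (borel_vec n) (borel_vec n) b)})"
    by (auto simp: fun_eq_iff split: bool.split)
  finally show ?thesis
    unfolding indep_var_def indep_vars_def2 using B0 W[OF s] by (auto split: bool.split)
qed

section \<open>The squared norm in mean square, and the limit in probability\<close>

lemma square_sum4_le: "(p + q + r + u)\<^sup>2 \<le> 4 * (p\<^sup>2 + q\<^sup>2 + r\<^sup>2 + u\<^sup>2)" for p q r u :: real
proof -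
  have "4 * (p\<^sup>2 + q\<^sup>2 + r\<^sup>2 + u\<^sup>2) - (p + q + r + u)\<^sup>2
     = (p - q)\<^sup>2 + (p - r)\<^sup>2 + (p - u)\<^sup>2 + (q - r)\<^sup>2 + (q - u)\<^sup>2 + (r - u)\<^sup>2"
    by algebra
  then show ?thesis by (smt (verit) zero_le_power2)
qed

text \<open>
  The bound is four times the sum of the second moments of the terms in the decomposition of the
  squared norm, each of order \<open>1 / (n - 1)\<close>; its numerator depends only on \<open>t\<close>, \<open>x\<close> and \<open>w\<close>.
\<close>

lemma brownian_motion_norm_second_moment:
  fixes l :: "nat \<Rightarrow> real"
  assumes n: "n \<ge> 2" and t: "t \<ge> 0" and x: "x \<ge> 0"
    and BM: "brownian_motion_drift P n (sphere_tilted n x (vscale n ((real n - 1) / 2) l))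
        (vscale n ((real n - 1) / 2) l) B"
  defines "w \<equiv> vnorm n l"
  shows "prob_space P" "B (2 * t / (real n - 1)) \<in> P \<rightarrow>\<^sub>M borel_vec n"
    "(\<integral>\<^sup>+\<omega>. ennreal (((vnorm n (B (2 * t / (real n - 1)) \<omega>))\<^sup>2 -
        (x\<^sup>2 + w\<^sup>2 * t\<^sup>2 + 2 * t * sqrt (x\<^sup>2 * w\<^sup>2 + 1)))\<^sup>2) \<partial>P)
     \<le> ennreal ((64 * t\<^sup>2 * (w * x)\<^sup>2 * (w * x + 1) + 32 * t * (x + t * w)\<^sup>2 + 80 * t\<^sup>2) / (real n - 1))"
proof -
  define N where "N = real n - 1"
  define s where "s = 2 * t / N"
  define a where "a = w * x"
  let ?d = "vscale n (N / 2) l" and ?\<mu> = "sphere_tilted n x (vscale n (N / 2) l)"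
  have N: "N \<ge> 1" using n by (simp add: N_def)
  have n1: "n \<ge> 1" using n by simp
  have s: "s \<ge> 0" using t N by (simp add: s_def)
  obtain B0 W where W: "standard_brownian_motion P n W" and B0[measurable]: "B0 \<in> P \<rightarrow>\<^sub>M borel_vec n"
    and law: "distr P (borel_vec n) B0 = ?\<mu>"
    and ind: "prob_space.indep_set P {B0 -` A \<inter> space P | A. A \<in> sets (borel_vec n)}
          {(\<lambda>\<omega>. \<lambda>s\<in>{0..}. W s \<omega>) -` A \<inter> space P | A. A \<in> sets (\<Pi>\<^sub>M s\<in>{0..}. borel_vec n)}"
    and B: "\<forall>s\<ge>0. \<forall>\<omega>\<in>space P. B s \<omega> = vadd n (vadd n (B0 \<omega>) (W s \<omega>)) (vscale n s ?d)"
    using BM unfolding brownian_motion_drift_def N_def by blast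
  show P: "prob_space P" using W by (simp add: standard_brownian_motion_def)
  interpret prob_space P by fact
  have mW: "W r \<in> P \<rightarrow>\<^sub>M borel_vec n" if "r \<ge> 0" for r
    using W that by (simp add: standard_brownian_motion_def)
  note mWs[measurable] = mW[OF s]
  define C where "C \<omega> = vadd n (B0 \<omega>) (vscale n t l)" for \<omega>
  have shift: "(\<lambda>b. vadd n b (vscale n t l)) \<in> borel_vec n \<rightarrow>\<^sub>M borel_vec n"
    by (intro measurable_vadd measurable_ident) (auto simp: space_PiM vscale_def)
  have C[measurable]: "C \<in> P \<rightarrow>\<^sub>M borel_vec n"
    unfolding C_def by (rule measurable_compose[OF B0 shift])
  have st: "s * (N / 2) = t" using N by (simp add: s_def)
  have Beq: "B s \<omega> = vadd n (C \<omega>) (W s \<omega>)" if "\<omega> \<in> space P" for \<omega>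
  proof -
    have "vscale n s ?d = vscale n t l"
      unfolding st[symmetric] by (auto simp: vscale_def fun_eq_iff)
    then show ?thesis using B s that by (auto simp: C_def vadd_def fun_eq_iff)
  qed
  show "B (2 * t / (real n - 1)) \<in> P \<rightarrow>\<^sub>M borel_vec n"
    unfolding N_def[symmetric] s_def[symmetric]
    by (subst measurable_cong[OF Beq]) (auto intro: measurable_vadd)
  \<comment> \<open>The deviation splits into four terms: the fluctuation of the inner product under the tilted
    law, the cross term, the fluctuation of the Gaussian squared norm, and the excess of its mean over
    \<open>2 t\<close>, which is \<open>2 t / N\<close> since the variances add up to \<open>n s\<close> with \<open>n = N + 1\<close>.\<close>
  let ?\<Delta> = "\<lambda>\<omega>. (vnorm n (B s \<omega>))\<^sup>2 - (x\<^sup>2 + w\<^sup>2 * t\<^sup>2 + 2 * t * sqrt (x\<^sup>2 * w\<^sup>2 + 1))"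
  let ?p = "\<lambda>\<omega>. (2 * t)\<^sup>2 * (vinner n l (B0 \<omega>) - tilt_root a)\<^sup>2"
    and ?q = "\<lambda>\<omega>. 4 * (vinner n (C \<omega>) (W s \<omega>))\<^sup>2"
    and ?r = "\<lambda>\<omega>. ((vnorm n (W s \<omega>))\<^sup>2 - real n * s)\<^sup>2"
  have AE0: "AE \<omega> in P. vnorm n (B0 \<omega>) = x"
  proof -
    have "AE y in distr P (borel_vec n) B0. vnorm n y = x"
      unfolding law by (rule AE_sphere_tilted_vnorm[OF n1 x])
    then show ?thesis by (subst (asm) AE_distr_iff) auto
  qed
  have nvs: "vnorm n (vscale n t l) = t * w" using t by (simp add: vnorm_vscale w_def)
  have pt: "AE \<omega> in P. (?\<Delta> \<omega>)\<^sup>2 \<le> 4 * (?p \<omega> + ?q \<omega> + ?r \<omega> + (2 * t / N)\<^sup>2)"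
    using AE0 AE_space
  proof eventually_elim
    case (elim \<omega>)
    have "vinner n (B0 \<omega>) (vscale n t l) = t * vinner n l (B0 \<omega>)"
      using vinner_vscale[of n t l "B0 \<omega>"] by (simp add: vinner_def mult.commute)
    then have "(vnorm n (C \<omega>))\<^sup>2 = x\<^sup>2 + 2 * t * vinner n l (B0 \<omega>) + (t * w)\<^sup>2"
      unfolding C_def vnorm_vadd_power2 nvs elim(1) by simp
    moreover have "real n * s = 2 * t + 2 * t / N"
      using N by (simp add: s_def N_def field_simps)
    moreover have "sqrt (x\<^sup>2 * w\<^sup>2 + 1) = tilt_root a + 1"
      by (simp add: tilt_root_def a_def power_mult_distrib mult.commute add.commute)
    ultimately have "?\<Delta> \<omega> = 2 * t * (vinner n l (B0 \<omega>) - tilt_root a) + 2 * vinner n (C \<omega>) (W s \<omega>)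
        + ((vnorm n (W s \<omega>))\<^sup>2 - real n * s) + 2 * t / N"
      unfolding Beq[OF elim(2)] vnorm_vadd_power2 by (simp add: algebra_simps power_mult_distrib)
    then show ?case
      using square_sum4_le[of "2 * t * (vinner n l (B0 \<omega>) - tilt_root a)" "2 * vinner n (C \<omega>) (W s \<omega>)"
        "(vnorm n (W s \<omega>))\<^sup>2 - real n * s" "2 * t / N"]
      by (simp add: power_mult_distrib)
  qed
  have [measurable]: "(\<lambda>\<omega>. vinner n (C \<omega>) (W s \<omega>)) \<in> borel_measurable P"
    by (intro measurable_vinner) measurable
  have Ip: "(\<integral>\<^sup>+\<omega>. ennreal ((vinner n l (B0 \<omega>) - tilt_root a)\<^sup>2) \<partial>P) \<le> ennreal (4 * a\<^sup>2 * (a + 1) / N)"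
  proof -
    have "(\<integral>\<^sup>+\<omega>. ennreal ((vinner n l (B0 \<omega>) - tilt_root a)\<^sup>2) \<partial>P)
       = (\<integral>\<^sup>+y. ennreal ((vinner n l y - tilt_root a)\<^sup>2) \<partial>distr P (borel_vec n) B0)"
      by (rule nn_integral_distr[symmetric]) measurable
    then show ?thesis
      unfolding law using sphere_tilted_variance[OF n x, of l] by (simp add: a_def w_def N_def)
  qed
  have Iq: "(\<integral>\<^sup>+\<omega>. ennreal ((vinner n (C \<omega>) (W s \<omega>))\<^sup>2) \<partial>P) \<le> ennreal (s * (x + t * w)\<^sup>2)"
  proof (rule indep_var_vinner_second_moment[OF P])
    have "indep_var (borel_vec n) B0 (borel_vec n) (W s)"
      using P B0 mW s ind by (rule indep_set_path_imp_indep_var)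
    from indep_var_compose[OF this shift measurable_ident]
    show "indep_var (borel_vec n) C (borel_vec n) (W s)" by (simp add: C_def[abs_def] comp_def)
    show "AE \<omega> in P. vnorm n (C \<omega>) \<le> x + t * w"
      using AE0 by eventually_elim (use vnorm_vadd_le nvs in \<open>metis C_def\<close>)
  qed (use brownian_motion_moments(1)[OF W s] s in auto)
  have Ir: "(\<integral>\<^sup>+\<omega>. ennreal (?r \<omega>) \<partial>P) = ennreal (2 * real n * s\<^sup>2)"
    by (rule brownian_motion_moments(2)[OF W s])
  have a0: "a \<ge> 0" using x vnorm_nonneg[of n l] by (simp add: a_def w_def)
  have "(\<integral>\<^sup>+\<omega>. ennreal ((?\<Delta> \<omega>)\<^sup>2) \<partial>P)
     \<le> (\<integral>\<^sup>+\<omega>. ennreal 4 * (ennreal ((2 * t)\<^sup>2) * ennreal ((vinner n l (B0 \<omega>) - tilt_root a)\<^sup>2)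
          + ennreal 4 * ennreal ((vinner n (C \<omega>) (W s \<omega>))\<^sup>2) + ennreal (?r \<omega>) + ennreal ((2 * t / N)\<^sup>2)) \<partial>P)"
  proof (rule nn_integral_mono_AE)
    show "AE \<omega> in P. ennreal ((?\<Delta> \<omega>)\<^sup>2) \<le> ennreal 4 * (ennreal ((2 * t)\<^sup>2) * ennreal ((vinner n l (B0 \<omega>) - tilt_root a)\<^sup>2)
          + ennreal 4 * ennreal ((vinner n (C \<omega>) (W s \<omega>))\<^sup>2) + ennreal (?r \<omega>) + ennreal ((2 * t / N)\<^sup>2))"
      using pt
      by eventually_elim
        (simp only: ennreal_mult'[symmetric] ennreal_plus[symmetric] zero_le_power2 zero_le_numeral
          mult_nonneg_nonneg add_nonneg_nonneg ennreal_leI)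
  qed
  also have "\<dots> = ennreal 4 * (ennreal ((2 * t)\<^sup>2) * (\<integral>\<^sup>+\<omega>. ennreal ((vinner n l (B0 \<omega>) - tilt_root a)\<^sup>2) \<partial>P)
          + ennreal 4 * (\<integral>\<^sup>+\<omega>. ennreal ((vinner n (C \<omega>) (W s \<omega>))\<^sup>2) \<partial>P)
          + (\<integral>\<^sup>+\<omega>. ennreal (?r \<omega>) \<partial>P) + ennreal ((2 * t / N)\<^sup>2))"
    by (simp add: nn_integral_add nn_integral_cmult emeasure_space_1)
  also have "\<dots> \<le> ennreal 4 * (ennreal ((2 * t)\<^sup>2) * ennreal (4 * a\<^sup>2 * (a + 1) / N)
          + ennreal 4 * ennreal (s * (x + t * w)\<^sup>2) + ennreal (2 * real n * s\<^sup>2) + ennreal ((2 * t / N)\<^sup>2))"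
    using Ip Iq Ir by (intro mult_left_mono add_mono) auto
  also have "\<dots> = ennreal (4 * ((2 * t)\<^sup>2 * (4 * a\<^sup>2 * (a + 1) / N) + 4 * (s * (x + t * w)\<^sup>2) + 2 * real n * s\<^sup>2 + (2 * t / N)\<^sup>2))"
  proof -
    have "0 \<le> 4 * a\<^sup>2 * (a + 1) / N" "0 \<le> s * (x + t * w)\<^sup>2" "0 \<le> 2 * real n * s\<^sup>2"
      using a0 N s by auto
    then show ?thesis
      by (simp only: ennreal_mult'[symmetric] ennreal_plus[symmetric] zero_le_power2 zero_le_numeral
          mult_nonneg_nonneg add_nonneg_nonneg)
  qed
  also have "\<dots> \<le> ennreal ((64 * t\<^sup>2 * a\<^sup>2 * (a + 1) + 32 * t * (x + t * w)\<^sup>2 + 80 * t\<^sup>2) / N)"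
  proof (rule ennreal_leI)
    \<comment> \<open>\<open>n \<le> 2 N\<close> because \<open>n \<ge> 2\<close>\<close>
    have "2 * real n * s\<^sup>2 \<le> 4 * N * s\<^sup>2" using n by (intro mult_right_mono) (auto simp: N_def)
    also have "\<dots> = 16 * t\<^sup>2 / N" using N by (simp add: s_def power2_eq_square field_simps)
    finally have 1: "2 * real n * s\<^sup>2 \<le> 16 * t\<^sup>2 / N" .
    have "(2 * t / N)\<^sup>2 = 4 * t\<^sup>2 / (N * N)" by (simp add: power2_eq_square)
    also have "\<dots> \<le> 4 * t\<^sup>2 / (N * 1)" using N by (intro divide_left_mono mult_left_mono) auto
    finally have 2: "(2 * t / N)\<^sup>2 \<le> 4 * t\<^sup>2 / N" by simp
    have 3: "4 * ((2 * t)\<^sup>2 * (4 * a\<^sup>2 * (a + 1) / N) + 4 * (s * (x + t * w)\<^sup>2) + 16 * t\<^sup>2 / N + 4 * t\<^sup>2 / N)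
      = (64 * t\<^sup>2 * a\<^sup>2 * (a + 1) + 32 * t * (x + t * w)\<^sup>2 + 80 * t\<^sup>2) / N"
      by (simp add: s_def add_divide_distrib power_mult_distrib)
    show "4 * ((2 * t)\<^sup>2 * (4 * a\<^sup>2 * (a + 1) / N) + 4 * (s * (x + t * w)\<^sup>2) + 2 * real n * s\<^sup>2 + (2 * t / N)\<^sup>2)
      \<le> (64 * t\<^sup>2 * a\<^sup>2 * (a + 1) + 32 * t * (x + t * w)\<^sup>2 + 80 * t\<^sup>2) / N"
      by (subst 3[symmetric]) (intro mult_left_mono add_mono order_refl 1 2; simp)
  qed
  finally show "(\<integral>\<^sup>+\<omega>. ennreal (((vnorm n (B (2 * t / (real n - 1)) \<omega>))\<^sup>2 -
        (x\<^sup>2 + w\<^sup>2 * t\<^sup>2 + 2 * t * sqrt (x\<^sup>2 * w\<^sup>2 + 1)))\<^sup>2) \<partial>P)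
     \<le> ennreal ((64 * t\<^sup>2 * (w * x)\<^sup>2 * (w * x + 1) + 32 * t * (x + t * w)\<^sup>2 + 80 * t\<^sup>2) / (real n - 1))"
    by (simp only: N_def s_def a_def)
qed

text \<open>
  This passes from squared norms to norms also when the limit \<open>r\<close> is \<open>0\<close>, where the square root is not
  differentiable.
\<close>

lemma square_diff_sqrt_le:
  assumes "z \<ge> 0" "r \<ge> 0"
  shows "(z - sqrt r)\<^sup>2 \<le> \<bar>z\<^sup>2 - r\<bar>"
proof -
  have "\<bar>z - sqrt r\<bar> \<le> \<bar>z + sqrt r\<bar>" using assms real_sqrt_ge_zero[OF assms(2)] by linarith
  then have "\<bar>z - sqrt r\<bar> * \<bar>z - sqrt r\<bar> \<le> \<bar>z - sqrt r\<bar> * \<bar>z + sqrt r\<bar>" by (intro mult_left_mono) auto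
  also have "\<dots> = \<bar>z\<^sup>2 - (sqrt r)\<^sup>2\<bar>" by (simp add: abs_mult[symmetric] power2_eq_square algebra_simps)
  finally show ?thesis using assms by (simp add: power2_eq_square abs_mult_self_eq)
qed

lemma prob_sqrt_deviation_le:
  assumes P: "prob_space P" and Z: "Z \<in> borel_measurable P" "\<And>\<omega>. Z \<omega> \<ge> 0" and r: "r \<ge> 0"
    and \<epsilon>: "\<epsilon> > 0" and K: "K \<ge> 0"
    and m: "(\<integral>\<^sup>+\<omega>. ennreal (((Z \<omega>)\<^sup>2 - r)\<^sup>2) \<partial>P) \<le> ennreal K"
  shows "measure P {\<omega> \<in> space P. \<bar>Z \<omega> - sqrt r\<bar> > \<epsilon>} \<le> K / \<epsilon> ^ 4"
proof -
  interpret prob_space P by fact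
  note Z(1)[measurable]
  let ?u = "\<lambda>\<omega>. ennreal (((Z \<omega>)\<^sup>2 - r)\<^sup>2)"
  have "emeasure P {\<omega> \<in> space P. \<bar>Z \<omega> - sqrt r\<bar> > \<epsilon>} \<le> emeasure P {\<omega> \<in> space P. 1 \<le> ennreal (1 / \<epsilon> ^ 4) * ?u \<omega>}"
  proof (rule emeasure_mono)
    show "{\<omega> \<in> space P. \<bar>Z \<omega> - sqrt r\<bar> > \<epsilon>} \<subseteq> {\<omega> \<in> space P. 1 \<le> ennreal (1 / \<epsilon> ^ 4) * ?u \<omega>}"
    proof safe
      fix \<omega> assume "\<bar>Z \<omega> - sqrt r\<bar> > \<epsilon>"
      then have "\<epsilon>\<^sup>2 \<le> \<bar>Z \<omega> - sqrt r\<bar>\<^sup>2" using \<epsilon> by (intro power_mono) auto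
      also have "\<dots> \<le> \<bar>(Z \<omega>)\<^sup>2 - r\<bar>" using square_diff_sqrt_le[OF Z(2) r] by simp
      finally have "(\<epsilon>\<^sup>2)\<^sup>2 \<le> \<bar>(Z \<omega>)\<^sup>2 - r\<bar>\<^sup>2" by (intro power_mono) auto
      then have "1 \<le> 1 / \<epsilon> ^ 4 * ((Z \<omega>)\<^sup>2 - r)\<^sup>2" using \<epsilon> by (simp add: field_simps flip: power_mult)
      then have "ennreal 1 \<le> ennreal (1 / \<epsilon> ^ 4 * ((Z \<omega>)\<^sup>2 - r)\<^sup>2)" by (rule ennreal_leI)
      then show "1 \<le> ennreal (1 / \<epsilon> ^ 4) * ?u \<omega>" 
        by (simp only: ennreal_mult''[symmetric] zero_le_power2 ennreal_1[symmetric])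
    qed
  qed measurable
  also have "\<dots> \<le> ennreal (1 / \<epsilon> ^ 4) * (\<integral>\<^sup>+\<omega>. ?u \<omega> * indicator (space P) \<omega> \<partial>P)"
    by (rule nn_integral_Markov_inequality) auto
  also have "(\<integral>\<^sup>+\<omega>. ?u \<omega> * indicator (space P) \<omega> \<partial>P) = (\<integral>\<^sup>+\<omega>. ?u \<omega> \<partial>P)"
    by (intro nn_integral_cong) simp
  also have "ennreal (1 / \<epsilon> ^ 4) * (\<integral>\<^sup>+\<omega>. ?u \<omega> \<partial>P) \<le> ennreal (1 / \<epsilon> ^ 4) * ennreal K"
    using m by (rule mult_left_mono) simp
  also have "\<dots> = ennreal (K / \<epsilon> ^ 4)" using K \<epsilon> by (simp add: ennreal_mult''[symmetric])
  finally show ?thesis using K \<epsilon> by (simp add: emeasure_eq_measure)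
qed

theorem corollary1p6:
  fixes t x w :: real
    and l :: "nat \<Rightarrow> nat \<Rightarrow> real"
    and P :: "nat \<Rightarrow> 'a measure"
    and B :: "nat \<Rightarrow> real \<Rightarrow> 'a \<Rightarrow> nat \<Rightarrow> real"
  assumes "t \<ge> 0" and "x \<ge> 0" and "w \<ge> 0"
    and "\<And>M. M \<ge> 2 \<Longrightarrow> l M \<in> space (borel_vec M)"
    and "\<And>M. M \<ge> 2 \<Longrightarrow> vnorm M (l M) = w"
    and "\<And>M. M \<ge> 2 \<Longrightarrow>
      brownian_motion_drift (P M) M
        (sphere_tilted M x (vscale M ((real M - 1) / 2) (l M)))
        (vscale M ((real M - 1) / 2) (l M)) (B M)"
  shows "tendsto_in_prob P
    (\<lambda>M \<omega>. vnorm M (B M (2 * t / (real M - 1)) \<omega>))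
    (sqrt (x\<^sup>2 + w\<^sup>2 * t\<^sup>2 + 2 * t * sqrt (x\<^sup>2 * w\<^sup>2 + 1)))"
  unfolding tendsto_in_prob_def
proof (intro allI impI)
  fix \<epsilon> :: real assume \<epsilon>: "\<epsilon> > 0"
  let ?r = "x\<^sup>2 + w\<^sup>2 * t\<^sup>2 + 2 * t * sqrt (x\<^sup>2 * w\<^sup>2 + 1)"
  let ?p = "\<lambda>M. measure (P M) {\<omega> \<in> space (P M). \<bar>vnorm M (B M (2 * t / (real M - 1)) \<omega>) - sqrt ?r\<bar> > \<epsilon>}"
  define K where "K = 64 * t\<^sup>2 * (w * x)\<^sup>2 * (w * x + 1) + 32 * t * (x + t * w)\<^sup>2 + 80 * t\<^sup>2"
  have K: "K \<ge> 0" using assms(1-3) by (simp add: K_def)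
  have bound: "?p M \<le> K / \<epsilon> ^ 4 * (1 / (real M - 1))" if M: "M \<ge> 2" for M
  proof -
    note bm = brownian_motion_norm_second_moment[OF M assms(1,2) assms(6)[OF M], unfolded assms(5)[OF M]]
    have "?p M \<le> K / (real M - 1) / \<epsilon> ^ 4"
    proof (rule prob_sqrt_deviation_le)
      show "(\<integral>\<^sup>+\<omega>. ennreal (((vnorm M (B M (2 * t / (real M - 1)) \<omega>))\<^sup>2 - ?r)\<^sup>2) \<partial>P M) \<le> ennreal (K / (real M - 1))"
        using bm(3) by (simp only: K_def)
      show "(\<lambda>\<omega>. vnorm M (B M (2 * t / (real M - 1)) \<omega>)) \<in> borel_measurable (P M)"
        by (rule measurable_compose[OF bm(2) measurable_vnorm])
    qed (use bm(1) K M \<epsilon> assms(1-3) in \<open>auto simp: vnorm_nonneg\<close>)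
    then show ?thesis by (simp add: mult.commute)
  qed
  have "filterlim (\<lambda>M. real M - 1) at_top sequentially"
    using filterlim_tendsto_add_at_top[OF tendsto_const filterlim_real_sequentially, of "-1"] by simp
  then have "(\<lambda>M. K / \<epsilon> ^ 4 * (1 / (real M - 1))) \<longlonglongrightarrow> K / \<epsilon> ^ 4 * 0"
    by (intro tendsto_mult tendsto_const tendsto_divide_0[OF tendsto_const] filterlim_at_top_imp_at_infinity)
  then have lim: "(\<lambda>M. K / \<epsilon> ^ 4 * (1 / (real M - 1))) \<longlonglongrightarrow> 0" by simp
  show "?p \<longlonglongrightarrow> 0"
  proof (rule tendsto_sandwich[OF _ _ tendsto_const lim])
    show "\<forall>\<^sub>F M in sequentially. ?p M \<le> K / \<epsilon> ^ 4 * (1 / (real M - 1))"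
      using eventually_ge_at_top[of 2] by eventually_elim (rule bound)
  qed auto
qed

end
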